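(* Let $G$ be a compact connected Hausdorff abelian topological group, let $X$ be a connected Hausdorff topological space, and let $p:X\to G$ be a finite-sheeted covering mapping of degree $k$. Suppose that the character group $\widehat G$ is $k$-divisible. Then $p$ is a homeomorphism.
   Context: A continuous surjection $p:X\to Y$ between topological spaces is a $k$-fold covering mapping (a finite-sheeted covering mapping of degree $k$), $k\in\mathbb N=\{1,2,\dots\}$, if every $y\in Y$ has an open neighborhood $W$ such that $p^{-1}(W)$ is a disjoint union of $k$ open sets $V_1,\dots,V_k$ of $X$, each mapped homeomorphically onto $W$ by $p$. $\widehat G$ denotes the (Pontryagin) character group of $G$, written additively. $\widehat G$ is $k$-divisible (admits division by $k$) if the homomorphism $\widehat G\to\widehat G$, $\chi\mapsto k\chi$, is surjective. *)

theory Defs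
  imports "HOL-Analysis.Analysis" "HOL-Algebra.Group"
begin

text \<open>The \<open>k\<close> sheets over \<open>W\<close> are \<open>V 1, \<dots>, V k\<close>; they are nonempty because \<open>W\<close> is.\<close>

definition fold_covering ::
    "nat \<Rightarrow> ('a::topological_space \<Rightarrow> 'b::topological_space) \<Rightarrow> bool"
  where
  "fold_covering k p \<longleftrightarrow>
     1 \<le> k \<and> continuous_on UNIV p \<and> surj p \<and>
     (\<forall>y. \<exists>W. open W \<and> y \<in> W \<and>
        (\<exists>V::nat \<Rightarrow> 'a set.
           p -` W = (\<Union>i\<in>{1..k}. V i) \<and>
           disjoint_family_on V {1..k} \<and>
           (\<forall>i\<in>{1..k}. open (V i) \<and> (\<exists>q. homeomorphism (V i) W p q))))"

text \<open>The circle is realised as the multiplicative group of unit complex numbers, so the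
  group operation of the character group is the pointwise product, and what is \<open>kf\<close> in
  additive notation is the power \<open>f [^] k\<close>. The topology of the character group
  plays no role here, only the group structure is recorded.\<close>

definition characters ::
    "('g::topological_ab_group_add \<Rightarrow> complex) set"
  where
  "characters =
     {f. continuous_on UNIV f \<and> (\<forall>x. f x \<in> sphere 0 1) \<and>
          (\<forall>x y. f (x + y) = f x * f y)}"

definition character_group ::
    "('g::topological_ab_group_add \<Rightarrow> complex) monoid"
  where
  "character_group =
     \<lparr>carrier = characters, mult = (\<lambda>f g x. f x * g x), one = (\<lambda>_. 1)\<rparr>"

definition divisible_by :: "nat \<Rightarrow> ('c, 'r) monoid_scheme \<Rightarrow> bool"
  where
  "divisible_by k A \<longleftrightarrow> (\<lambda>f. f [^]\<^bsub>A\<^esub> k) ` carrier A = carrier A"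

lemma comm_group_character_group:
  "comm_group (character_group :: ('g::topological_ab_group_add \<Rightarrow> complex) monoid)"
proof (rule comm_groupI)
  fix f :: "'g \<Rightarrow> complex"
  assume "f \<in> carrier character_group"
  then have c: "continuous_on UNIV f" and n: "\<And>x. norm (f x) = 1"
    and h: "\<And>x y. f (x + y) = f x * f y"
    by (auto simp: character_group_def characters_def)
  have nz: "f x \<noteq> 0" for x
    using n[of x] by auto
  have "(\<lambda>x. inverse (f x)) \<in> characters"
    using c n nz h by (auto simp: characters_def norm_inverse intro!: continuous_intros)
  then show "\<exists>g\<in>carrier character_group.
      g \<otimes>\<^bsub>character_group\<^esub> f = \<one>\<^bsub>character_group\<^esub>"
    using nz by (auto simp: character_group_def fun_eq_iff
        intro!: bexI[where x = "\<lambda>x. inverse (f x)"])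
qed (auto simp: character_group_def characters_def norm_mult fun_eq_iff
    intro!: continuous_intros)

lemma character_group_pow:
  "f [^]\<^bsub>character_group\<^esub> (k::nat) = (\<lambda>x. f x ^ k)"
  by (induction k) (auto simp: character_group_def nat_pow_def)

end

theory Submission
  imports Defs "HOL-Library.Function_Algebras" "HOL-Algebra.Free_Abelian_Groups"
begin

text \<open>The covering space \<open>X\<close> carries a group structure for which \<open>p\<close> is a homomorphism with a kernel of order
\<open>k\<close>. For a continuous character \<open>\<psi>\<close> of \<open>X\<close>, the power \<open>\<psi> ^ k\<close> is trivial on the kernel, so it is the
pullback of a character of \<open>G\<close>, which by hypothesis is \<open>\<phi> ^ k\<close> for a character \<open>\<phi>\<close> of \<open>G\<close>. The
quotient of \<open>\<psi>\<close> by the pullback of \<open>\<phi>\<close> has values in the \<open>k\<close>-th roots of unity and is constant since \<open>X\<close> is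
connected. Hence every character of \<open>X\<close> is pulled back from \<open>G\<close> and is trivial on the kernel
(\<open>fibre_in_kernel\<close>). As the characters of \<open>X\<close> separate points, the kernel is trivial and
\<open>p\<close> is injective; being open, it is a homeomorphism.

The group structure arises from lifts of small translations of \<open>G\<close> to homeomorphisms of \<open>X\<close>
(\<open>small_shifts\<close>). These lifts commute (\<open>commuting_shifts\<close>), and by connectedness the group that they
generate is transitive on \<open>X\<close> (\<open>words_transitive\<close>); being abelian, it acts freely
(\<open>words_free\<close>). So \<open>X\<close> may be identified with that group.

The separation of points is obtained without Haar measure. A continuous function on \<open>X\<close> that distinguishes two
points yields a totally bounded seminorm on the group, and it is enough to show that every element of positive
seminorm is mapped away from 1 by some character that is Lipschitz for the seminorm (\<open>lipschitz_character\<close>).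
By Tychonoff's theorem this reduces to approximate characters on finite sets, with uniform constants
(\<open>approximate_character\<close>). A finitely generated piece of the group looks like \<open>(\<int>/N)^F\<close> for a common
almost period \<open>N\<close>, and there one chooses a character at which a bump function has a large Fourier coefficient.
Such a character is Lipschitz because the bump function is (\<open>large_coefficient_modulus\<close>), and it can be chosen
nontrivial at a given point by the argument of Bogolyubov with fourth powers of Fourier coefficients
(\<open>large_coefficient\<close>).\<close>

section \<open>Fourier analysis on a finite quotient group\<close>

text \<open>The finite abelian group \<open>H / P\<close> is never formed as a type. A function on it is a \<open>P\<close>-periodic
function on \<open>H\<close>, a mean over it is a mean over the transversal \<open>B\<close>, and the family \<open>e l\<close>
is its dual group, of which only the orthogonality relation matters. The index \<open>o0\<close> marks the
trivial character.\<close>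

locale finite_quotient =
  fixes P B :: "'h::ab_group_add set" and L :: "'l set" and e :: "'l \<Rightarrow> 'h \<Rightarrow> complex"
    and o0 :: 'l
  assumes finite_B: "finite B"
    and finite_L: "finite L"
    and zero_P: "0 \<in> P"
    and diff_P: "\<And>x y. x \<in> P \<Longrightarrow> y \<in> P \<Longrightarrow> x - y \<in> P"
    and transversal: "\<And>x. \<exists>!b. b \<in> B \<and> x - b \<in> P"
    and char_add: "\<And>l x y. l \<in> L \<Longrightarrow> e l (x + y) = e l x * e l y"
    and norm_char: "\<And>l x. l \<in> L \<Longrightarrow> norm (e l x) = 1"
    and char_period: "\<And>l x. l \<in> L \<Longrightarrow> x \<in> P \<Longrightarrow> e l x = 1"
    and orthogonality: "\<And>x. (\<Sum>l\<in>L. e l x) = (if x \<in> P then of_nat (card B) else 0)"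
    and trivial_index: "o0 \<in> L"
    and trivial_char: "\<And>x. e o0 x = 1"
begin

lemma uminus_P: "x \<in> P \<Longrightarrow> - x \<in> P"
  using diff_P[of 0 x] zero_P by simp

definition periodic :: "('h \<Rightarrow> 'b) \<Rightarrow> bool"
  where "periodic f \<longleftrightarrow> (\<forall>x y. x - y \<in> P \<longrightarrow> f x = f y)"

lemma periodicD: "periodic f \<Longrightarrow> x - y \<in> P \<Longrightarrow> f x = f y"
  by (auto simp: periodic_def)

definition rep :: "'h \<Rightarrow> 'h"
  where "rep x = (THE b. b \<in> B \<and> x - b \<in> P)"

lemma rep: "rep x \<in> B" "x - rep x \<in> P"
  using theI'[OF transversal[of x]] by (auto simp: rep_def)

lemma rep_unique: "b \<in> B \<Longrightarrow> x - b \<in> P \<Longrightarrow> rep x = b"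
  using transversal[of x] rep[of x] by blast

lemma rep_P: "rep x - x \<in> P"
  using uminus_P[OF rep(2)[of x]] by simp

lemma B_nonempty: "B \<noteq> {}"
  using rep(1) by blast

lemma card_B: "0 < card B"
  using B_nonempty finite_B by (simp add: card_gt_0_iff)

lemma sum_shift:
  assumes "periodic f"
  shows "(\<Sum>b\<in>B. f (b + z)) = (\<Sum>b\<in>B. f b :: 'b::comm_monoid_add)"
proof (rule sum.reindex_bij_witness[where i = "\<lambda>b. rep (b - z)" and j = "\<lambda>b. rep (b + z)"])
  fix b assume b: "b \<in> B"
  show "rep (rep (b + z) - z) = b"
    by (rule rep_unique[OF b]) (use rep_P[of "b + z"] in \<open>simp add: algebra_simps\<close>)
  show "rep (rep (b - z) + z) = b"
    by (rule rep_unique[OF b]) (use rep_P[of "b - z"] in \<open>simp add: algebra_simps\<close>)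
  show "f (rep (b + z)) = f (b + z)"
    by (rule periodicD[OF assms rep_P])
qed (auto simp: rep)

lemma char_uminus: "l \<in> L \<Longrightarrow> e l (- x) = cnj (e l x)"
proof -
  assume l: "l \<in> L"
  have "e l x * e l (- x) = 1"
    using char_add[OF l, of x "- x"] char_period[OF l zero_P] by simp
  moreover have "e l x * cnj (e l x) = 1"
    using norm_char[OF l, of x] by (simp add: complex_norm_square[symmetric])
  moreover have "e l x \<noteq> 0"
    using norm_char[OF l, of x] by auto
  ultimately show ?thesis
    by (metis mult_left_cancel)
qed

lemma char_diff: "l \<in> L \<Longrightarrow> e l (x - y) = e l x * cnj (e l y)"
  using char_add[of l x "- y"] char_uminus[of l y] by simp

lemma periodic_char: "l \<in> L \<Longrightarrow> periodic (e l)"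
  unfolding periodic_def
proof (intro allI impI)
  fix x y assume l: "l \<in> L" and "x - y \<in> P"
  then show "e l x = e l y"
    using char_add[OF l, of "x - y" y] char_period[OF l] by simp
qed

definition fourier :: "('h \<Rightarrow> real) \<Rightarrow> 'l \<Rightarrow> complex"
  where "fourier f l = (\<Sum>b\<in>B. f b * cnj (e l b)) / card B"

text \<open>The convolution of \<open>f\<close> with its reflection; its Fourier coefficients are nonnegative.\<close>

definition corr :: "('h \<Rightarrow> real) \<Rightarrow> 'h \<Rightarrow> real"
  where "corr f z = (\<Sum>b\<in>B. f b * f (b + z)) / card B"

lemma periodic_corr: "periodic f \<Longrightarrow> periodic (corr f)"
  unfolding periodic_def[of "corr f"] corr_def
  by (auto intro!: sum.cong arg_cong2[of _ _ _ _ "(*)"] periodicD[of f])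

text \<open>Expand the squares and sum over the characters first: by orthogonality only the pairs
\<open>b = b' + z\<close> modulo \<open>P\<close> survive. The case \<open>z = 0\<close> is Parseval's identity.\<close>

lemma sum_fourier_char:
  assumes f: "periodic f"
  shows "(\<Sum>l\<in>L. (cmod (fourier f l))\<^sup>2 * e l z) = corr f z"
proof -
  let ?n = "of_nat (card B) :: complex"
  have n: "?n \<noteq> 0"
    using card_B by simp
  have *: "(cmod (fourier f l))\<^sup>2 * e l z =
      (\<Sum>b'\<in>B. \<Sum>b\<in>B. f b * f b' * e l (b' + z - b)) / ?n\<^sup>2" if l: "l \<in> L" for l
  proof -
    have "complex_of_real ((cmod (fourier f l))\<^sup>2) = fourier f l * cnj (fourier f l)"
      by (rule complex_norm_square)
    also have "\<dots> = ((\<Sum>b\<in>B. f b * cnj (e l b)) * (\<Sum>b'\<in>B. f b' * e l b')) / ?n\<^sup>2"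
      by (simp add: fourier_def power2_eq_square)
    also have "(\<Sum>b\<in>B. f b * cnj (e l b)) * (\<Sum>b'\<in>B. f b' * e l b')
        = (\<Sum>b'\<in>B. \<Sum>b\<in>B. f b * cnj (e l b) * (f b' * e l b'))"
      unfolding sum_product by (rule sum.swap)
    finally have "(cmod (fourier f l))\<^sup>2 * e l z
        = (\<Sum>b'\<in>B. \<Sum>b\<in>B. f b * cnj (e l b) * (f b' * e l b') * e l z) / ?n\<^sup>2"
      by (simp add: sum_distrib_right)
    moreover have "f b * cnj (e l b) * (f b' * e l b') * e l z = f b * f b' * e l (b' + z - b)" for b b'
      using l by (simp add: char_diff char_add)
    ultimately show ?thesis by simp
  qed
  have inner: "(\<Sum>b\<in>B. f b * f b' * (\<Sum>l\<in>L. e l (b' + z - b))) = f b' * f (b' + z) * ?n" for b'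
  proof -
    have "(\<Sum>b\<in>B. f b * f b' * (\<Sum>l\<in>L. e l (b' + z - b)))
        = (\<Sum>b\<in>B. if b = rep (b' + z) then f b * f b' * ?n else 0)"
      by (rule sum.cong) (auto simp: orthogonality rep dest: rep_unique)
    also have "\<dots> = f (rep (b' + z)) * f b' * ?n"
      using finite_B rep by simp
    also have "f (rep (b' + z)) = f (b' + z)"
      by (rule periodicD[OF f rep_P])
    finally show ?thesis by simp
  qed
  have "(\<Sum>l\<in>L. (cmod (fourier f l))\<^sup>2 * e l z) =
      (\<Sum>l\<in>L. \<Sum>b'\<in>B. \<Sum>b\<in>B. f b * f b' * e l (b' + z - b)) / ?n\<^sup>2"
    using * by (simp add: sum_divide_distrib)
  also have "(\<Sum>l\<in>L. \<Sum>b'\<in>B. \<Sum>b\<in>B. f b * f b' * e l (b' + z - b))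
      = (\<Sum>b'\<in>B. \<Sum>b\<in>B. f b * f b' * (\<Sum>l\<in>L. e l (b' + z - b)))"
    by (simp add: sum_distrib_left sum.swap[of _ _ L])
  also have "\<dots> = (\<Sum>b'\<in>B. f b' * f (b' + z) * ?n)"
    by (rule sum.cong[OF refl inner])
  finally show ?thesis
    using n by (simp add: corr_def power2_eq_square sum_distrib_right[symmetric])
qed

lemma fourier_shift:
  assumes f: "periodic f" and l: "l \<in> L"
  shows "fourier (\<lambda>x. f (x + z)) l = e l z * fourier f l"
proof -
  have "(\<Sum>b\<in>B. f b * cnj (e l b)) = (\<Sum>b\<in>B. f (b + z) * cnj (e l (b + z)))"
    by (rule sum_shift[symmetric])
      (use f periodic_char[OF l] in \<open>auto simp: periodic_def\<close>)
  also have "\<dots> = cnj (e l z) * (\<Sum>b\<in>B. f (b + z) * cnj (e l b))"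
    using l by (simp add: char_add sum_distrib_left ac_simps)
  finally have "e l z * (\<Sum>b\<in>B. f b * cnj (e l b))
      = (e l z * cnj (e l z)) * (\<Sum>b\<in>B. f (b + z) * cnj (e l b))"
    by simp
  moreover have "e l z * cnj (e l z) = 1"
    using norm_char[OF l, of z] by (simp add: complex_norm_square[symmetric])
  ultimately show ?thesis
    by (simp add: fourier_def)
qed

lemma fourier_corr:
  assumes f: "periodic f" and l: "l \<in> L"
  shows "fourier (corr f) l = (cmod (fourier f l))\<^sup>2"
proof -
  let ?n = "of_nat (card B) :: complex"
  have "fourier (corr f) l = (\<Sum>z\<in>B. \<Sum>b\<in>B. f b * f (b + z) * cnj (e l z)) / ?n / ?n"
    by (simp add: fourier_def corr_def sum_distrib_right sum_divide_distrib)
  also have "\<dots> = (\<Sum>b\<in>B. f b * (\<Sum>z\<in>B. f (b + z) * cnj (e l z))) / ?n / ?n"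
    by (subst sum.swap) (simp add: sum_distrib_left ac_simps)
  also have "\<dots> = (\<Sum>b\<in>B. f b * fourier (\<lambda>z. f (z + b)) l) / ?n"
  proof -
    have "fourier (\<lambda>z. f (z + b)) l = (\<Sum>z\<in>B. f (b + z) * cnj (e l z)) / ?n" for b
      by (simp add: fourier_def add.commute)
    then show ?thesis
      by (simp only: times_divide_eq_right sum_divide_distrib[symmetric])
  qed
  also have "\<dots> = (\<Sum>b\<in>B. f b * e l b) / ?n * fourier f l"
    by (simp only: fourier_shift[OF f l] mult.assoc[symmetric] sum_distrib_right[symmetric]
        times_divide_eq_left)
  also have "(\<Sum>b\<in>B. f b * e l b) / ?n = cnj (fourier f l)"
    by (simp add: fourier_def)
  finally show ?thesis
    by (subst complex_norm_square) (simp add: mult.commute)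
qed

lemma fourier_trivial: "fourier f o0 = (\<Sum>b\<in>B. f b) / card B"
  by (simp add: fourier_def trivial_char)

text \<open>Translating \<open>f\<close> by \<open>z\<close> multiplies its coefficient at \<open>l\<close> by \<open>e l z\<close>, so a character at which
\<open>f\<close> has a large coefficient moves under \<open>z\<close> no more than \<open>f\<close> does, up to a constant.\<close>

lemma large_coefficient_modulus:
  assumes f: "periodic f" and l: "l \<in> L" and M: "\<And>x. \<bar>f (x + z) - f x\<bar> \<le> M"
  shows "cmod (fourier f l) * cmod (e l z - 1) \<le> M"
proof -
  have "cmod (fourier f l) * cmod (e l z - 1) = cmod (fourier (\<lambda>x. f (x + z)) l - fourier f l)"
    unfolding fourier_shift[OF f l] by (simp add: norm_mult[symmetric] algebra_simps)
  also have "\<dots> = cmod (\<Sum>b\<in>B. (f (b + z) - f b) * cnj (e l b)) / card B"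
    by (simp add: fourier_def sum_subtractf diff_divide_distrib[symmetric] left_diff_distrib norm_divide)
  also have "\<dots> \<le> (\<Sum>b\<in>B. M) / card B"
    using M norm_char[OF l]
    by (intro divide_right_mono sum_norm_le) (auto simp: norm_mult simp flip: of_real_diff)
  finally show ?thesis
    using card_B by simp
qed

text \<open>This is the argument of Bogolyubov. Let \<open>W l\<close> be the square of the modulus of the coefficient. As
\<open>corr (corr f)\<close> has the coefficients \<open>W l ^ 2\<close> and vanishes at \<open>a\<close>, the sum of
\<open>W l ^ 2 * (1 - Re (e l a))\<close> equals that of \<open>W l ^ 2\<close>, which is at least \<open>b ^ 4\<close> because of
the trivial character. Since the \<open>W l\<close> add up to at most 1, the indices with \<open>W l < b ^ 4 / 4\<close>
and those with \<open>e l a\<close> close to 1 together account for at most half of this. The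
fourth powers of the coefficients are what makes the many small ones negligible.\<close>

lemma large_coefficient:
  assumes f: "periodic f" and f01: "\<And>x. 0 \<le> f x" "\<And>x. f x \<le> 1"
    and mean: "b \<le> (\<Sum>x\<in>B. f x) / card B" and b: "0 < b"
    and a: "corr (corr f) a = 0"
  obtains l where "l \<in> L" "b\<^sup>2 / 2 \<le> cmod (fourier f l)" "b ^ 4 / 2 \<le> 1 - Re (e l a)"
proof -
  define W where "W l = (cmod (fourier f l))\<^sup>2" for l
  have W0: "0 \<le> W l" for l by (simp add: W_def)
  have re: "\<bar>Re (e l a)\<bar> \<le> 1" if "l \<in> L" for l
    using abs_Re_le_cmod[of "e l a"] norm_char[OF that] by simp
  have "complex_of_real (\<Sum>l\<in>L. W l) = (\<Sum>l\<in>L. (cmod (fourier f l))\<^sup>2 * e l 0)"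
    using char_period zero_P by (simp add: W_def)
  also have "\<dots> = corr f 0" by (rule sum_fourier_char[OF f])
  finally have "(\<Sum>l\<in>L. W l) = corr f 0" using of_real_eq_iff by blast
  also have "corr f 0 \<le> (\<Sum>b\<in>B. 1) / card B"
    unfolding corr_def using f01
    by (intro divide_right_mono sum_mono) (auto intro: mult_le_one)
  finally have sumW: "(\<Sum>l\<in>L. W l) \<le> 1"
    using card_B by simp
  have W1: "W l \<le> 1" if "l \<in> L" for l
    using sumW member_le_sum[OF that, of W] W0 finite_L by (meson order_trans)
  have four: "(\<Sum>l\<in>L. (W l)\<^sup>2 * e l z) = corr (corr f) z" for z
  proof -
    have "(\<Sum>l\<in>L. (W l)\<^sup>2 * e l z) = (\<Sum>l\<in>L. (cmod (fourier (corr f) l))\<^sup>2 * e l z)"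
      by (rule sum.cong) (simp_all add: fourier_corr[OF f] W_def norm_power)
    then show ?thesis
      using sum_fourier_char[OF periodic_corr[OF f]] by simp
  qed
  have "(\<Sum>l\<in>L. (W l)\<^sup>2 * Re (e l a)) = Re (\<Sum>l\<in>L. (W l)\<^sup>2 * e l a)"
    by (simp add: Re_sum flip: of_real_power)
  also have "\<dots> = 0" by (simp only: four a) simp
  finally have re0: "(\<Sum>l\<in>L. (W l)\<^sup>2 * Re (e l a)) = 0" .
  have "b\<^sup>2 \<le> W o0"
    using mean b unfolding W_def fourier_trivial
    by (auto simp: norm_divide abs_of_nonneg sum_nonneg f01 intro!: power_mono simp flip: of_real_sum)
  then have "b ^ 4 \<le> (W o0)\<^sup>2"
    using power_mono[of "b\<^sup>2" "W o0" 2] by simp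
  also have "\<dots> \<le> (\<Sum>l\<in>L. (W l)\<^sup>2)"
    using trivial_index finite_L by (intro member_le_sum) auto
  also have "\<dots> = (\<Sum>l\<in>L. (W l)\<^sup>2 * (1 - Re (e l a)))"
    by (simp add: right_diff_distrib sum_subtractf re0)
  finally have lower: "b ^ 4 \<le> (\<Sum>l\<in>L. (W l)\<^sup>2 * (1 - Re (e l a)))" .
  have "\<exists>l\<in>L. b ^ 4 / 4 \<le> W l \<and> b ^ 4 / 2 \<le> 1 - Re (e l a)"
  proof (rule ccontr)
    assume "\<not> ?thesis"
    then have neg: "W l < b ^ 4 / 4 \<or> 1 - Re (e l a) < b ^ 4 / 2" if "l \<in> L" for l
      using that by force
    have "(W l)\<^sup>2 * (1 - Re (e l a)) \<le> W l * (b ^ 4 / 2)" if l: "l \<in> L" for l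
    proof -
      have "W l * (1 - Re (e l a)) \<le> b ^ 4 / 2"
        using neg[OF l]
      proof
        assume "W l < b ^ 4 / 4"
        then have "W l * (1 - Re (e l a)) \<le> (b ^ 4 / 4) * 2"
          using re[OF l] W0 by (intro mult_mono) auto
        then show ?thesis by simp
      next
        assume "1 - Re (e l a) < b ^ 4 / 2"
        then have "W l * (1 - Re (e l a)) \<le> 1 * (b ^ 4 / 2)"
          using re[OF l] W0[of l] W1[OF l] by (intro mult_mono) auto
        then show ?thesis by simp
      qed
      from mult_left_mono[OF this W0[of l]] show ?thesis
        by (simp add: power2_eq_square mult.assoc)
    qed
    then have "(\<Sum>l\<in>L. (W l)\<^sup>2 * (1 - Re (e l a))) \<le> (\<Sum>l\<in>L. W l * (b ^ 4 / 2))"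
      by (rule sum_mono)
    also have "\<dots> = (\<Sum>l\<in>L. W l) * (b ^ 4 / 2)"
      by (simp add: sum_distrib_right)
    also have "\<dots> \<le> 1 * (b ^ 4 / 2)"
      using sumW b by (intro mult_right_mono) auto
    finally show False
      using lower b by (smt (verit) zero_less_power field_sum_of_halves)
  qed
  then obtain l where l: "l \<in> L" "b ^ 4 / 4 \<le> W l" "b ^ 4 / 2 \<le> 1 - Re (e l a)" by blast
  have "(b\<^sup>2 / 2)\<^sup>2 \<le> (cmod (fourier f l))\<^sup>2"
    using l(2) by (simp add: W_def power_divide)
  then have "b\<^sup>2 / 2 \<le> cmod (fourier f l)"
    by (rule power2_le_imp_le) simp
  then show thesis using that l by blast
qed

text \<open>Some fibre of \<open>c\<close> has at least \<open>card B / \<kappa>\<close> elements, and translating it by minus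
one of its elements carries it into the region where \<open>f\<close> is at least \<open>s\<close>.\<close>

lemma mean_ge_by_covering:
  assumes f: "periodic f" "\<And>x. 0 \<le> f x"
    and c: "card (c ` B) \<le> \<kappa>" and near: "\<And>x y. x \<in> B \<Longrightarrow> y \<in> B \<Longrightarrow> c x = c y \<Longrightarrow> s \<le> f (x - y)"
    and s: "0 \<le> s"
  shows "s / \<kappa> \<le> (\<Sum>x\<in>B. f x) / card B"
proof -
  have "\<exists>y\<in>c ` B. card B / \<kappa> \<le> card {b\<in>B. c b = y}"
  proof (rule ccontr)
    assume "\<not> ?thesis"
    then have *: "real (card {b\<in>B. c b = y}) < card B / \<kappa>" if "y \<in> c ` B" for y
      using that by force
    have k: "0 < \<kappa>"
      using c B_nonempty finite_B by (metis card_gt_0_iff finite_imageI image_is_empty less_le_trans)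
    have "real (card B) = (\<Sum>y\<in>c ` B. real (card {b\<in>B. c b = y}))"
      using finite_B sum.image_gen[of B "\<lambda>_. 1::real" c] by simp
    also have "\<dots> < (\<Sum>y\<in>c ` B. card B / \<kappa>)"
      using * finite_B B_nonempty by (intro sum_strict_mono) auto
    also have "\<dots> = card (c ` B) * (card B / \<kappa>)" by simp
    also have "\<dots> \<le> \<kappa> * (card B / \<kappa>)"
      using c by (intro mult_right_mono) auto
    finally show False using k by simp
  qed
  then obtain b0 where b0: "b0 \<in> B" and big: "card B / \<kappa> \<le> card {b\<in>B. c b = c b0}" by blast
  have "s * (card B / \<kappa>) \<le> s * card {b\<in>B. c b = c b0}"
    using big s by (rule mult_left_mono)
  also have "\<dots> = (\<Sum>b\<in>{b\<in>B. c b = c b0}. s)"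
    by simp
  also have "\<dots> \<le> (\<Sum>b\<in>{b\<in>B. c b = c b0}. f (b - b0))"
    using near b0 by (intro sum_mono) auto
  also have "\<dots> \<le> (\<Sum>b\<in>B. f (b + - b0))"
    using finite_B f(2) by (simp add: sum_mono2)
  also have "\<dots> = (\<Sum>b\<in>B. f b)"
    by (rule sum_shift[OF f(1)])
  finally show ?thesis
    using card_B by (simp add: field_simps)
qed

text \<open>The function \<open>f = max 0 (1 - D / r)\<close> is Lipschitz for \<open>D\<close> and lives where \<open>D < r\<close>; hence
\<open>corr f\<close> lives where \<open>D\<close> is below about \<open>2 * r\<close> and \<open>corr (corr f)\<close> where it is below about
\<open>4 * r\<close>, which excludes \<open>a\<close>. The error \<open>\<eta>\<close> allows for a \<open>D\<close> that is subadditive only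
approximately. The bounds depend on the group only through the covering number \<open>\<kappa>\<close>; this
uniformity is what a later passage to the limit needs.\<close>

lemma separating_character:
  fixes D :: "'h \<Rightarrow> real"
  assumes D: "periodic D" "\<And>x. 0 \<le> D x" "D 0 = 0" "\<And>x y. D (x - y) \<le> D x + D y + \<eta>"
    and r: "0 < r" and eta: "0 \<le> \<eta>" "3 * \<eta> \<le> r" and a: "5 * r \<le> D a"
    and k: "0 < \<kappa>" and c: "card (c ` B) \<le> \<kappa>"
    and near: "\<And>x y. x \<in> B \<Longrightarrow> y \<in> B \<Longrightarrow> c x = c y \<Longrightarrow> D (x - y) \<le> r / 2"
  obtains l where "l \<in> L"
    "\<And>z. cmod (e l z - 1) \<le> (8 * real \<kappa> ^ 2 / r) * (D z + 2 * \<eta>)"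
    "1 / (32 * \<kappa> ^ 4) \<le> 1 - Re (e l a)"
proof -
  define f where "f x = max 0 (1 - D x / r)" for x
  define b where "b = 1 / (2 * real \<kappa>)"
  have b: "0 < b" using k by (simp add: b_def)
  have f: "periodic f"
    using D(1) by (simp add: periodic_def f_def)
  have f01: "0 \<le> f x" "f x \<le> 1" for x
    using D(2) r by (auto simp: f_def)
  have supp: "D x < r" if "f x \<noteq> 0" for x
    using that r by (auto simp: f_def max_def field_simps split: if_splits)
  have Dneg: "D (- z) \<le> D z + \<eta>" for z
    using D(4)[of 0 z] D(3) by simp
  have lip: "\<bar>f (x + z) - f x\<bar> \<le> (D z + 2 * \<eta>) / r" for x z
  proof -
    have "D (x + z) \<le> D x + D z + 2 * \<eta>"
      using D(4)[of x "- z"] Dneg[of z] by simp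
    moreover have "D x \<le> D (x + z) + D z + \<eta>"
      using D(4)[of "x + z" z] by simp
    ultimately have "\<bar>D (x + z) - D x\<bar> \<le> D z + 2 * \<eta>"
      using eta by linarith
    then have "\<bar>D (x + z) / r - D x / r\<bar> \<le> (D z + 2 * \<eta>) / r"
      using r by (simp add: diff_divide_distrib[symmetric] divide_right_mono)
    then show ?thesis
      unfolding f_def by linarith
  qed
  \<comment> \<open>Two points of the support of \<open>f\<close> differ by less than this in \<open>D\<close>.\<close>
  have corr0: "corr f m = 0" if "2 * r + \<eta> \<le> D m" for m
  proof -
    have "f b * f (b + m) = 0" for b
    proof (rule ccontr)
      assume "f b * f (b + m) \<noteq> 0"
      then have "D b < r" "D (b + m) < r" using supp by auto
      then show False using that D(4)[of "b + m" b] by simp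
    qed
    then have "(\<Sum>b\<in>B. f b * f (b + m)) = 0" by (intro sum.neutral) blast
    then show ?thesis by (simp add: corr_def)
  qed
  have "corr f b * corr f (b + a) = 0" for b
  proof (rule ccontr)
    assume "corr f b * corr f (b + a) \<noteq> 0"
    then have "D b < 2 * r + \<eta>" "D (b + a) < 2 * r + \<eta>"
      using corr0[of b] corr0[of "b + a"] by (auto simp: not_le[symmetric])
    then show False using a eta D(4)[of "b + a" b] by simp
  qed
  then have "(\<Sum>b\<in>B. corr f b * corr f (b + a)) = 0" by (intro sum.neutral) blast
  then have corra: "corr (corr f) a = 0"
    by (simp add: corr_def[of "corr f"])
  have "b = (1/2) / \<kappa>" by (simp add: b_def)
  also have "\<dots> \<le> (\<Sum>x\<in>B. f x) / card B"
  proof (rule mean_ge_by_covering[OF f f01(1) c])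
    fix x y assume "x \<in> B" "y \<in> B" "c x = c y"
    from near[OF this] have "D (x - y) / r \<le> 1 / 2"
      using r by (simp add: field_simps)
    then show "1 / 2 \<le> f (x - y)" unfolding f_def by linarith
  qed auto
  finally obtain l where l: "l \<in> L" "b\<^sup>2 / 2 \<le> cmod (fourier f l)" "b ^ 4 / 2 \<le> 1 - Re (e l a)"
    using large_coefficient[OF f f01 _ b corra] by blast
  have "cmod (e l z - 1) \<le> (8 * real \<kappa> ^ 2 / r) * (D z + 2 * \<eta>)" for z
  proof -
    have "(b\<^sup>2 / 2) * cmod (e l z - 1) \<le> cmod (fourier f l) * cmod (e l z - 1)"
      using l by (intro mult_right_mono) auto
    also have "\<dots> \<le> (D z + 2 * \<eta>) / r"
      by (rule large_coefficient_modulus[OF f l(1) lip])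
    finally show ?thesis
      using k r by (simp add: b_def field_simps power2_eq_square)
  qed
  moreover have "1 / (32 * real \<kappa> ^ 4) \<le> 1 - Re (e l a)"
    using l(3) by (simp add: b_def power_divide power_mult_distrib)
  ultimately show thesis using that l(1) by blast
qed

end

section \<open>Lipschitz characters for a totally bounded seminorm\<close>

definition int_multiple :: "int \<Rightarrow> 'a::ab_group_add \<Rightarrow> 'a"
  where "int_multiple n x = (if 0 \<le> n then ((+) x ^^ nat n) 0 else - (((+) x ^^ nat (- n)) 0))"

lemma int_multiple_0 [simp]: "int_multiple 0 x = 0"
  by (simp add: int_multiple_def)

lemma int_multiple_add_1: "int_multiple (n + 1) x = int_multiple n x + x"
proof (cases "0 \<le> n")
  case True
  then show ?thesis by (simp add: int_multiple_def nat_add_distrib add.commute)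
next
  case False
  then have "nat (- n) = Suc (nat (- (n + 1)))" by simp
  then show ?thesis using False by (cases "n = -1") (simp_all add: int_multiple_def)
qed

lemma int_multiple_diff_1: "int_multiple (n - 1) x = int_multiple n x - x"
  using int_multiple_add_1[of "n - 1" x] by simp

lemma int_multiple_1 [simp]: "int_multiple 1 x = x"
  using int_multiple_add_1[of 0 x] by simp

lemma int_multiple_add: "int_multiple (m + n) x = int_multiple m x + int_multiple n x"
proof (induction n rule: int_induct[where k = 0])
  case (step1 i)
  then show ?case using int_multiple_add_1[of "m + i" x] int_multiple_add_1[of i x] by (simp add: algebra_simps)
next
  case (step2 i)
  then show ?case by (simp only: add_diff_eq int_multiple_diff_1)
qed simp

lemma int_multiple_diff: "int_multiple (m - n) x = int_multiple m x - int_multiple n x"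
  using int_multiple_add[of "m - n" n x] by simp

lemma int_multiple_mult: "int_multiple (m * n) x = int_multiple m (int_multiple n x)"
proof (induction m rule: int_induct[where k = 0])
  case (step1 i)
  then show ?case using int_multiple_add[of "i * n" n x] int_multiple_add_1[of i "int_multiple n x"] by (simp add: algebra_simps)
next
  case (step2 i)
  then show ?case by (simp only: left_diff_distrib mult_1_left int_multiple_diff int_multiple_1)
qed simp

locale group_seminorm =
  fixes d :: "'a::ab_group_add \<Rightarrow> real"
  assumes zero: "d 0 = 0"
    and minus: "\<And>x. d (- x) = d x"
    and triangle: "\<And>x y. d (x + y) \<le> d x + d y"
begin

lemma nonneg: "0 \<le> d x"
  using triangle[of x "- x"] zero minus[of x] by simp

lemma diff: "d (x - y) \<le> d x + d y"
  using triangle[of x "- y"] minus[of y] by simp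

lemma sum_le: "d (\<Sum>i\<in>I. g i) \<le> (\<Sum>i\<in>I. d (g i))"
proof (induction I rule: infinite_finite_induct)
  case (insert x I)
  then show ?case using triangle[of "g x" "sum g I"] by simp
qed (simp_all add: zero)

lemma int_multiple_le: "d (int_multiple n x) \<le> \<bar>real_of_int n\<bar> * d x"
proof (induction n rule: int_induct[where k = 0])
  case (step1 i)
  then show ?case using int_multiple_add_1[of i x] triangle[of "int_multiple i x" x] by (simp add: algebra_simps)
next
  case (step2 i)
  then show ?case using diff[of "int_multiple i x" x] nonneg[of x] by (simp add: int_multiple_diff_1 algebra_simps)
qed (simp add: zero)

definition tot_bounded :: bool
  where "tot_bounded \<longleftrightarrow> (\<forall>\<epsilon>>0. \<exists>C. finite C \<and> (\<forall>x. \<exists>c\<in>C. d (x - c) < \<epsilon>))"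

lemma nearest:
  assumes tot_bounded and "0 < \<epsilon>"
  obtains C c where "finite C" "\<And>x. c x \<in> C" "\<And>x. d (x - c x) < \<epsilon>"
proof -
  obtain C where C: "finite C" "\<forall>x. \<exists>c\<in>C. d (x - c) < \<epsilon>"
    using assms by (auto simp: tot_bounded_def)
  define c where "c x = (SOME c. c \<in> C \<and> d (x - c) < \<epsilon>)" for x
  have "c x \<in> C \<and> d (x - c x) < \<epsilon>" for x
    unfolding c_def by (rule someI_ex) (use C in blast)
  then show thesis using that C by blast
qed

lemma same_nearest:
  assumes "\<And>x. d (x - c x) < \<epsilon>" and "c x = c y"
  shows "d (x - y) < 2 * \<epsilon>"
  using diff[of "x - c x" "y - c y"] assms(1)[of x] assms(1)[of y] assms(2) by simp

text \<open>Among the infinitely many multiples \<open>n\<close>, two have all their points \<open>n x\<close>, for \<open>x\<close> in the finite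
set, near the same centres of a finite \<open>\<delta> / 2\<close>-net; their difference is a common almost period.\<close>

lemma common_almost_period:
  assumes tb: tot_bounded and F: "finite F" and \<delta>: "0 < \<delta>"
  obtains N :: nat where "0 < N" "\<And>x. x \<in> F \<Longrightarrow> d (int_multiple (int N) x) \<le> \<delta>"
proof -
  obtain C c where C: "finite C" "\<And>x. c x \<in> C" and c: "\<And>x. d (x - c x) < \<delta> / 2"
    using nearest[OF tb, of "\<delta> / 2"] \<delta> by auto
  define \<phi> where "\<phi> n = (\<lambda>x\<in>F. c (int_multiple (int n) x))" for n :: nat
  have "range \<phi> \<subseteq> PiE F (\<lambda>_. C)"
    using C by (auto simp: \<phi>_def)
  then have "finite (range \<phi>)"
    using finite_PiE[OF F, of "\<lambda>_. C"] C(1) finite_subset by blast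
  then have "\<not> inj \<phi>"
    using finite_imageD infinite_UNIV_nat by blast
  then obtain m n where "m \<noteq> n" "\<phi> m = \<phi> n"
    by (auto simp: inj_def)
  then obtain m n where mn: "m < n" "\<phi> m = \<phi> n"
    by (metis nat_neq_iff)
  show thesis
  proof (rule that[of "n - m"])
    fix x assume x: "x \<in> F"
    have "c (int_multiple (int n) x) = c (int_multiple (int m) x)"
      using fun_cong[OF mn(2), of x] x by (simp add: \<phi>_def)
    from same_nearest[of c "\<delta> / 2", OF c this] show "d (int_multiple (int (n - m)) x) \<le> \<delta>"
      using mn by (simp add: int_multiple_diff of_nat_diff)
  qed (use mn in simp)
qed

end

text \<open>The transversal and the characters of \<open>(\<int>/N)^F\<close>, regarded as the quotient of all integer functions by those
divisible by \<open>N\<close> on \<open>F\<close>. Values off \<open>F\<close> are irrelevant for the quotient, and the extensional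
functions of \<open>PiE\<close> make the representative unique.\<close>

definition residue_box :: "'a set \<Rightarrow> nat \<Rightarrow> ('a \<Rightarrow> int) set"
  where "residue_box F N = PiE F (\<lambda>_. {0..<int N})"

definition residue_char :: "'a set \<Rightarrow> nat \<Rightarrow> ('a \<Rightarrow> nat) \<Rightarrow> ('a \<Rightarrow> int) \<Rightarrow> complex"
  where "residue_char F N l n = (\<Prod>x\<in>F. cis (2 * pi * n x / N) ^ l x)"

lemma root_of_unity_sum:
  assumes N: "0 < (N::nat)"
  shows "(\<Sum>j<N. cis (2 * pi * real_of_int n / N) ^ j) = (if int N dvd n then of_nat N else 0)"
proof (cases "int N dvd n")
  case True
  then obtain q where "n = int N * q" by blast
  then have "2 * pi * real_of_int n / N = 2 * pi * real_of_int q"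
    using N by simp
  then have "cis (2 * pi * real_of_int n / N) = 1"
    by (simp add: cis_multiple_2pi)
  then show ?thesis using True by simp
next
  case False
  let ?z = "cis (2 * pi * real_of_int n / N)"
  have "?z \<noteq> 1"
  proof
    assume "?z = 1"
    then have "cos (2 * pi * real_of_int n / N) = 1"
      by (metis cis.simps(1) one_complex.simps(1))
    then obtain q :: int where "2 * pi * real_of_int n / N = real_of_int q * (2 * pi)"
      by (auto simp: cos_one_2pi_int)
    then have "real_of_int n = real_of_int (q * int N)"
      using N by (simp add: field_simps)
    then have "n = q * int N" by linarith
    with False show False by simp
  qed
  moreover have "?z ^ N = cis (2 * pi * real_of_int n)"
    unfolding Complex.DeMoivre using N by simp
  then have "?z ^ N = 1"
    by (simp add: cis_multiple_2pi)
  ultimately show ?thesis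
    using False by (simp add: geometric_sum)
qed

text \<open>Orthogonality factorises: the sum over all exponents \<open>l\<close> of a product over \<open>F\<close> is the product over \<open>F\<close>
of geometric sums of roots of unity.\<close>

lemma finite_quotient_residues:
  assumes F: "finite F" and N: "0 < N"
  shows "finite_quotient {n. \<forall>x\<in>F. int N dvd n x} (residue_box F N)
    (PiE F (\<lambda>_. {..<N})) (residue_char F N) (\<lambda>x\<in>F. 0)"
proof
  show "finite (residue_box F N)" "finite (PiE F (\<lambda>_. {..<N}))"
    using F by (auto simp: residue_box_def intro!: finite_PiE)
  show "0 \<in> {n. \<forall>x\<in>F. int N dvd n x}" by simp
  show "x - y \<in> {n. \<forall>x\<in>F. int N dvd n x}"
    if "x \<in> {n. \<forall>x\<in>F. int N dvd n x}" "y \<in> {n. \<forall>x\<in>F. int N dvd n x}" for x y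
    using that by (auto intro: dvd_diff)
  show "\<exists>!b. b \<in> residue_box F N \<and> n - b \<in> {n. \<forall>x\<in>F. int N dvd n x}" for n
  proof (rule ex1I[of _ "\<lambda>x\<in>F. n x mod int N"])
    show "(\<lambda>x\<in>F. n x mod int N) \<in> residue_box F N \<and>
        n - (\<lambda>x\<in>F. n x mod int N) \<in> {n. \<forall>x\<in>F. int N dvd n x}"
      using N by (auto simp: residue_box_def)
  next
    fix b assume b: "b \<in> residue_box F N \<and> n - b \<in> {n. \<forall>x\<in>F. int N dvd n x}"
    show "b = (\<lambda>x\<in>F. n x mod int N)"
    proof
      fix x
      show "b x = (\<lambda>x\<in>F. n x mod int N) x"
      proof (cases "x \<in> F")
        case True
        then have "0 \<le> b x" "b x < int N" "int N dvd n x - b x"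
          using b by (auto simp: residue_box_def PiE_iff)
        then show ?thesis
          using True by (metis mod_eq_dvd_iff mod_pos_pos_trivial restrict_apply')
      next
        case False
        then show ?thesis using b by (auto simp: residue_box_def PiE_iff extensional_def)
      qed
    qed
  qed
  show "residue_char F N l (m + n) = residue_char F N l m * residue_char F N l n" for l m n
    by (simp add: residue_char_def cis_mult power_mult_distrib[symmetric] add_divide_distrib
        distrib_left flip: prod.distrib)
  show "norm (residue_char F N l n) = 1" for l n
    by (simp add: residue_char_def prod_norm[symmetric] norm_power)
  show "residue_char F N l n = 1" if n: "n \<in> {n. \<forall>x\<in>F. int N dvd n x}" for l n
    unfolding residue_char_def
  proof (rule prod.neutral, rule ballI)
    fix x assume "x \<in> F"
    then obtain q where "n x = int N * q" using n by blast
    then have "2 * pi * real_of_int (n x) / N = 2 * pi * real_of_int q"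
      using N by simp
    then show "cis (2 * pi * real_of_int (n x) / N) ^ l x = 1"
      by (simp add: cis_multiple_2pi)
  qed
  show "(\<Sum>l\<in>PiE F (\<lambda>_. {..<N}). residue_char F N l n) =
      (if n \<in> {n. \<forall>x\<in>F. int N dvd n x} then of_nat (card (residue_box F N)) else 0)" for n
  proof -
    have "(\<Sum>l\<in>PiE F (\<lambda>_. {..<N}). residue_char F N l n)
        = (\<Prod>x\<in>F. \<Sum>j<N. cis (2 * pi * n x / N) ^ j)"
      unfolding residue_char_def using F by (simp add: prod_sum_PiE)
    also have "\<dots> = (\<Prod>x\<in>F. if int N dvd n x then of_nat N else 0)"
      by (simp add: root_of_unity_sum[OF N])
    also have "\<dots> = (if \<forall>x\<in>F. int N dvd n x then of_nat N ^ card F else 0)"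
      using F by (auto intro!: prod_zero)
    finally show ?thesis
      using F by (simp add: residue_box_def card_PiE)
  qed
  show "(\<lambda>x\<in>F. 0) \<in> PiE F (\<lambda>_. {..<N})" using N by auto
  show "residue_char F N (\<lambda>x\<in>F. 0) n = 1" for n
    by (simp add: residue_char_def)
qed

context group_seminorm
begin

definition comb :: "'a set \<Rightarrow> ('a \<Rightarrow> int) \<Rightarrow> 'a"
  where "comb F n = (\<Sum>x\<in>F. int_multiple (n x) x)"

lemma comb_diff: "comb F (m - n) = comb F m - comb F n"
  by (simp add: comb_def int_multiple_diff sum_subtractf)

lemma comb_add: "comb F (m + n) = comb F m + comb F n"
  by (simp add: comb_def int_multiple_add sum.distrib)

definition unit :: "'a \<Rightarrow> 'a \<Rightarrow> int"
  where "unit x = (\<lambda>y. if y = x then 1 else 0)"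

lemma comb_unit: "finite F \<Longrightarrow> x \<in> F \<Longrightarrow> comb F (unit x) = x"
  by (simp add: comb_def unit_def if_distrib[of "\<lambda>n. int_multiple n _"] cong: if_cong)

text \<open>The seminorm carried over to \<open>(\<int>/N)^F\<close> by reducing the coefficients to \<open>{0..<N}\<close>. When \<open>N\<close> is an
almost period of all elements of \<open>F\<close>, the reduction hardly matters and \<open>dmod\<close> is almost a seminorm.\<close>

definition dmod :: "'a set \<Rightarrow> nat \<Rightarrow> ('a \<Rightarrow> int) \<Rightarrow> real"
  where "dmod F N n = d (comb F (\<lambda>x. n x mod int N))"

text \<open>Reduction changes the combination by \<open>(n x div N)\<close> times the almost null element \<open>N x\<close> for every \<open>x\<close> in \<open>F\<close>.\<close>

lemma dmod_bounds:
  fixes \<delta> :: real and q :: int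
  assumes \<delta>: "\<And>x. x \<in> F \<Longrightarrow> d (int_multiple (int N) x) \<le> \<delta>"
    and q: "\<And>x. x \<in> F \<Longrightarrow> \<bar>n x div int N\<bar> \<le> q"
  shows "dmod F N n \<le> d (comb F n) + card F * (q * \<delta>)"
    and "d (comb F n) \<le> dmod F N n + card F * (q * \<delta>)"
proof -
  define E where "E = (\<Sum>x\<in>F. int_multiple (n x div int N) (int_multiple (int N) x))"
  have "int_multiple (n x) x = int_multiple (n x mod int N) x + int_multiple (n x div int N) (int_multiple (int N) x)" for x
    by (simp flip: int_multiple_mult int_multiple_add)
  then have eq: "comb F n = comb F (\<lambda>x. n x mod int N) + E"
    by (simp add: comb_def E_def sum.distrib)
  have "d E \<le> (\<Sum>x\<in>F. d (int_multiple (n x div int N) (int_multiple (int N) x)))"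
    unfolding E_def by (rule sum_le)
  also have "\<dots> \<le> (\<Sum>x\<in>F. q * \<delta>)"
  proof (rule sum_mono)
    fix x assume x: "x \<in> F"
    have "d (int_multiple (n x div int N) (int_multiple (int N) x)) \<le> \<bar>real_of_int (n x div int N)\<bar> * d (int_multiple (int N) x)"
      by (rule int_multiple_le)
    also have "\<dots> \<le> q * \<delta>"
      using q[OF x] \<delta>[OF x] nonneg by (intro mult_mono) (simp_all flip: of_int_abs)
    finally show "d (int_multiple (n x div int N) (int_multiple (int N) x)) \<le> q * \<delta>" .
  qed
  finally have E: "d E \<le> card F * (q * \<delta>)" by simp
  show "dmod F N n \<le> d (comb F n) + card F * (q * \<delta>)"
    using diff[of "comb F n" E] E by (simp add: dmod_def eq)
  show "d (comb F n) \<le> dmod F N n + card F * (q * \<delta>)"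
    using triangle[of "comb F (\<lambda>x. n x mod int N)" E] E by (simp add: dmod_def eq)
qed

lemma div_small:
  assumes N: "0 < N" and m: "- int q * int N \<le> m" "m < (int q + 1) * int N"
  shows "\<bar>m div int N\<bar> \<le> int q"
proof -
  have "- int q \<le> m div int N"
    using zdiv_mono1[OF m(1), of "int N"] N by (simp only: nonzero_mult_div_cancel_right)
  moreover have "m div int N < int q + 1"
  proof (rule ccontr)
    assume "\<not> m div int N < int q + 1"
    then have "(int q + 1) * int N \<le> (m div int N) * int N"
      by (intro mult_right_mono) auto
    also have "\<dots> \<le> m"
      using div_mult_mod_eq[of m "int N"] pos_mod_sign[of "int N" m] N by linarith
    finally show False using m(2) by simp
  qed
  ultimately show ?thesis by linarith
qed

text \<open>On \<open>F\<close>, the function is a Lipschitz homomorphism to the circle up to \<open>\<epsilon>\<close>, and \<open>c\<close> keeps its value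
at \<open>a\<close> away from 1. Each of these conditions is closed for pointwise convergence.\<close>

definition almost_character ::
    "real \<Rightarrow> real \<Rightarrow> 'a \<Rightarrow> 'a set \<Rightarrow> real \<Rightarrow> ('a \<Rightarrow> complex) \<Rightarrow> bool"
  where "almost_character K c a F \<epsilon> \<psi> \<longleftrightarrow>
    (\<forall>x. norm (\<psi> x) = 1) \<and> (\<forall>x\<in>F. norm (\<psi> x - 1) \<le> K * d x + \<epsilon>) \<and>
    (\<forall>x\<in>F. \<forall>y\<in>F. x + y \<in> F \<longrightarrow> norm (\<psi> (x + y) - \<psi> x * \<psi> y) \<le> \<epsilon>) \<and>
    c \<le> 1 - Re (\<psi> a)"

text \<open>The subgroup generated by \<open>F\<close> is compared with the finite group \<open>(\<int>/N)^F\<close>, where \<open>N\<close> is a common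
almost period, and a separating character of that group is evaluated at the unit vectors. An additive
relation \<open>x + y = w\<close> in \<open>F\<close> gives a vector whose combination is 0, so the character is
close to 1 there. The order of the quantifiers is essential: \<open>K\<close> and \<open>c\<close> come from a finite net of the
whole group and do not depend on \<open>F\<close>.\<close>

lemma approximate_character:
  assumes tb: tot_bounded and r: "0 < r" "6 * r \<le> d a"
  obtains K c :: real where "0 < c"
    "\<And>F \<epsilon>. finite F \<Longrightarrow> a \<in> F \<Longrightarrow> 0 < \<epsilon> \<Longrightarrow>
      \<exists>\<psi>. almost_character K c a F \<epsilon> \<psi>"
proof -
  obtain C c where C: "finite C" "\<And>x. c x \<in> C" and c: "\<And>x. d (x - c x) < r / 8"
    using nearest[OF tb, of "r / 8"] r by auto
  define \<kappa> where "\<kappa> = card C"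
  have \<kappa>: "0 < \<kappa>"
    using C unfolding \<kappa>_def by (metis card_gt_0_iff empty_iff)
  define K where "K = 8 * real \<kappa> ^ 2 / r"
  have K: "0 < K" using \<kappa> r by (simp add: K_def)
  show thesis
  proof (rule that[of "1 / (32 * real \<kappa> ^ 4)" K])
    show "0 < 1 / (32 * real \<kappa> ^ 4)" using \<kappa> by simp
  next
    fix F and \<epsilon> :: real
    assume F: "finite F" "a \<in> F" and \<epsilon>: "0 < \<epsilon>"
    \<comment> \<open>The cost of reducing coefficients modulo \<open>N\<close> once; the estimates below pay it at most 8 times.\<close>
    define t where "t = min (r / 9) (\<epsilon> / (8 * K))"
    have t: "0 < t" "9 * t \<le> r" "8 * K * t \<le> \<epsilon>"
      using r \<epsilon> K by (auto simp: t_def min_def field_simps)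
    define \<delta> where "\<delta> = t / card F"
    have cF: "0 < card F" using F by (auto simp: card_gt_0_iff)
    have \<delta>: "0 < \<delta>" "card F * \<delta> = t" using t cF by (auto simp: \<delta>_def)
    obtain N where N: "0 < N" and N\<delta>: "\<And>x. x \<in> F \<Longrightarrow> d (int_multiple (int N) x) \<le> \<delta>"
      by (rule common_almost_period[OF tb F(1) \<delta>(1)]) blast
    interpret Q: finite_quotient "{n. \<forall>x\<in>F. int N dvd n x}" "residue_box F N"
      "PiE F (\<lambda>_. {..<N})" "residue_char F N" "\<lambda>x\<in>F. 0"
      by (rule finite_quotient_residues[OF F(1) N])
    define D where "D = dmod F N"
    have bounds: "D n \<le> d (comb F n) + q * t" "d (comb F n) \<le> D n + q * t"
      if q: "\<And>x. x \<in> F \<Longrightarrow> - int q * int N \<le> n x \<and> n x < (int q + 1) * int N" for q n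
    proof -
      have "\<bar>n x div int N\<bar> \<le> int q" if "x \<in> F" for x
        using div_small[OF N] q[OF that] by blast
      from dmod_bounds[where F = F and n = n and N = N, OF N\<delta> this]
      show "D n \<le> d (comb F n) + q * t" "d (comb F n) \<le> D n + q * t"
        unfolding D_def \<delta>(2)[symmetric] by (simp_all add: algebra_simps)
    qed
    have cong: "D m = D n" if "\<And>x. x \<in> F \<Longrightarrow> m x mod int N = n x mod int N" for m n
      unfolding D_def dmod_def comb_def using that by (intro arg_cong[of _ _ d] sum.cong) auto
    have per: "Q.periodic D"
      unfolding Q.periodic_def by (auto intro!: cong simp: mod_eq_dvd_iff)
    have box_diff: "D (m - n) \<le> d (comb F m - comb F n) + t"
      if box: "\<And>x. x \<in> F \<Longrightarrow> m x \<in> {0..<int N}" "\<And>x. x \<in> F \<Longrightarrow> n x \<in> {0..<int N}" for m n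
    proof -
      have "- int 1 * int N \<le> (m - n) x \<and> (m - n) x < (int 1 + 1) * int N" if "x \<in> F" for x
        using box[OF that] by auto
      from bounds(1)[of 1 "m - n", OF this] show ?thesis by (simp add: comb_diff)
    qed
    have tri: "D (m - n) \<le> D m + D n + 3 * t" for m n
    proof -
      let ?m = "\<lambda>x. m x mod int N" and ?n = "\<lambda>x. n x mod int N"
      have "D (m - n) = D (?m - ?n)"
        by (rule cong) (simp add: mod_diff_eq)
      also have "\<dots> \<le> d (comb F ?m - comb F ?n) + t"
        by (rule box_diff) (use N in auto)
      also have "d (comb F ?m - comb F ?n) \<le> D m + D n"
        unfolding D_def dmod_def by (rule diff)
      finally show ?thesis using t by simp
    qed
    have unit1: "- int 1 * int N \<le> unit x y \<and> unit x y < (int 1 + 1) * int N" for x y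
      using N by (auto simp: unit_def)
    have far: "5 * r \<le> D (unit a)"
      using bounds(2)[of 1 "unit a", OF unit1] F r t by (simp add: comb_unit)
    have few: "card ((\<lambda>n. c (comb F n)) ` residue_box F N) \<le> \<kappa>"
      unfolding \<kappa>_def using C by (intro card_mono) auto
    have near: "D (m - n) \<le> r / 2"
      if "m \<in> residue_box F N" "n \<in> residue_box F N" "c (comb F m) = c (comb F n)" for m n
    proof -
      have "D (m - n) \<le> d (comb F m - comb F n) + t"
        by (rule box_diff) (use that in \<open>auto simp: residue_box_def PiE_iff\<close>)
      also have "\<dots> \<le> 2 * (r / 8) + r / 9"
        using same_nearest[of c "r / 8", OF c that(3)] t by simp
      finally show ?thesis using r by simp
    qed
    have nonneg_D: "0 \<le> D n" for n by (simp add: D_def dmod_def nonneg)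
    have D_0: "D 0 = 0" by (simp add: D_def dmod_def comb_def zero)
    have t3: "0 \<le> 3 * t" "3 * (3 * t) \<le> r" using t by auto
    obtain l where l: "l \<in> PiE F (\<lambda>_. {..<N})"
      and modulus: "\<And>z. cmod (residue_char F N l z - 1) \<le> K * (D z + 2 * (3 * t))"
      and away: "1 / (32 * real \<kappa> ^ 4) \<le> 1 - Re (residue_char F N l (unit a))"
      using Q.separating_character[OF per nonneg_D D_0 tri r(1) t3 far \<kappa> few near]
      unfolding K_def by blast
    define \<psi> where "\<psi> x = residue_char F N l (unit x)" for x
    have "norm (\<psi> x) = 1" for x
      unfolding \<psi>_def by (rule Q.norm_char[OF l])
    moreover have "norm (\<psi> x - 1) \<le> K * d x + \<epsilon>" if x: "x \<in> F" for x
    proof -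
      have "norm (\<psi> x - 1) \<le> K * (D (unit x) + 6 * t)"
        using modulus[of "unit x"] by (simp add: \<psi>_def)
      also have "\<dots> \<le> K * (d x + 8 * t)"
        using bounds(1)[of 1 "unit x", OF unit1] F x K t by (simp add: comb_unit)
      finally show ?thesis using t by (simp add: algebra_simps)
    qed
    moreover have "norm (\<psi> (x + y) - \<psi> x * \<psi> y) \<le> \<epsilon>" if xy: "x \<in> F" "y \<in> F" "x + y \<in> F" for x y
    proof -
      let ?z = "unit x + unit y - unit (x + y)"
      have "- int 2 * int N \<le> ?z w \<and> ?z w < (int 2 + 1) * int N" for w
        using N by (auto simp: unit_def)
      from bounds(1)[of 2 ?z, OF this] have "D ?z \<le> 2 * t"
        using xy F by (simp add: comb_diff comb_add comb_unit zero)
      then have "K * (D ?z + 6 * t) \<le> K * (8 * t)"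
        using K by simp
      then have *: "cmod (residue_char F N l ?z - 1) \<le> \<epsilon>"
        using modulus[of ?z] t by simp
      have "residue_char F N l ?z * \<psi> (x + y) = \<psi> x * \<psi> y"
        unfolding \<psi>_def Q.char_add[OF l, symmetric] by simp
      then have "\<psi> x * \<psi> y - \<psi> (x + y) = (residue_char F N l ?z - 1) * \<psi> (x + y)"
        by (simp add: algebra_simps)
      then have "norm (\<psi> x * \<psi> y - \<psi> (x + y)) = cmod (residue_char F N l ?z - 1)"
        using Q.norm_char[OF l] by (simp add: norm_mult \<psi>_def)
      with * show ?thesis by (simp add: norm_minus_commute)
    qed
    moreover have "1 / (32 * real \<kappa> ^ 4) \<le> 1 - Re (\<psi> a)"
      using away by (simp add: \<psi>_def)
    ultimately show "\<exists>\<psi>. almost_character K (1 / (32 * real \<kappa> ^ 4)) a F \<epsilon> \<psi>"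
      unfolding almost_character_def by blast
  qed
qed

lemma compact_circle_functions:
  "compact (PiE UNIV (\<lambda>_. sphere 0 1) :: ('a \<Rightarrow> complex) set)"
  using compactin_PiE[of "\<lambda>_. euclidean" UNIV "\<lambda>_::'a. sphere (0::complex) 1"]
  by (simp add: euclidean_product_topology)

text \<open>By compactness of the product of circles over all group elements, the almost characters for larger and
larger \<open>F\<close> and smaller and smaller \<open>\<epsilon>\<close> have a common limit, which is a character.\<close>

lemma lipschitz_character:
  assumes tb: tot_bounded and a: "0 < d a"
  obtains \<psi> :: "'a \<Rightarrow> complex" and K where "\<And>x. norm (\<psi> x) = 1"
    "\<And>x y. \<psi> (x + y) = \<psi> x * \<psi> y" "\<And>x. norm (\<psi> x - 1) \<le> K * d x" "\<psi> a \<noteq> 1"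
proof -
  have r: "0 < d a / 6" "6 * (d a / 6) \<le> d a" using a by auto
  obtain K c where c: "0 < c" and approx: "\<And>F \<epsilon>. finite F \<Longrightarrow> a \<in> F \<Longrightarrow> 0 < \<epsilon> \<Longrightarrow>
      \<exists>\<psi>. almost_character K c a F \<epsilon> \<psi>"
    by (rule approximate_character[OF tb r]) (rule that)
  define T where "T = (\<lambda>(F, \<epsilon>). Collect (almost_character K c a F \<epsilon>))"
  define I where "I = {(F, \<epsilon>). finite (F :: 'a set) \<and> a \<in> F \<and> 0 < (\<epsilon> :: real)}"
  have coord: "continuous_on UNIV (\<lambda>\<psi> :: 'a \<Rightarrow> complex. \<psi> x)" for x
    by (rule continuous_on_product_coordinates)
  have closed_T: "closed (T i)" for i
    unfolding T_def case_prod_unfold almost_character_def Ball_def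
    by (intro closed_Collect_conj closed_Collect_all closed_Collect_imp
        closed_Collect_le closed_Collect_eq open_Collect_const continuous_intros coord)
  have fip: "PiE UNIV (\<lambda>_. sphere 0 1) \<inter> (\<Inter>i\<in>I'. T i) \<noteq> {}" if I': "finite I'" "I' \<subseteq> I" for I'
  proof -
    define F where "F = insert a (\<Union>(fst ` I'))"
    define \<epsilon> where "\<epsilon> = Min (insert 1 (snd ` I'))"
    have "finite F" "a \<in> F" "0 < \<epsilon>"
      using I' by (auto simp: F_def \<epsilon>_def I_def)
    from approx[OF this] obtain \<psi> where \<psi>: "almost_character K c a F \<epsilon> \<psi>" by blast
    have "\<psi> \<in> T i" if i: "i \<in> I'" for i
    proof -
      have "fst i \<subseteq> F" using i by (auto simp: F_def)
      moreover have "\<epsilon> \<le> snd i" using i I' by (auto simp: \<epsilon>_def)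
      ultimately have "almost_character K c a (fst i) (snd i) \<psi>"
        using \<psi> unfolding almost_character_def by (smt (verit) subsetD)
      then show ?thesis by (simp add: T_def case_prod_unfold)
    qed
    moreover have "\<psi> \<in> PiE UNIV (\<lambda>_. sphere 0 1)"
      using \<psi> by (auto simp: almost_character_def)
    ultimately have "\<psi> \<in> PiE UNIV (\<lambda>_. sphere 0 1) \<inter> (\<Inter>i\<in>I'. T i)" by blast
    then show ?thesis by blast
  qed
  have "PiE UNIV (\<lambda>_. sphere 0 1) \<inter> (\<Inter>i\<in>I. T i) \<noteq> {}"
    by (rule compact_imp_fip_image[OF compact_circle_functions closed_T fip])
  then obtain \<psi> where \<psi>1: "\<psi> \<in> PiE UNIV (\<lambda>_. sphere 0 1)" and \<psi>T: "\<And>i. i \<in> I \<Longrightarrow> \<psi> \<in> T i"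
    by blast
  show thesis
  proof (rule that[of \<psi> K])
    show "norm (\<psi> x) = 1" for x using \<psi>1 by (auto simp: PiE_iff)
    show "\<psi> (x + y) = \<psi> x * \<psi> y" for x y
    proof -
      have "norm (\<psi> (x + y) - \<psi> x * \<psi> y) \<le> 0"
      proof (rule field_le_epsilon)
        fix \<epsilon> :: real assume "0 < \<epsilon>"
        then have "({a, x, y, x + y}, \<epsilon>) \<in> I" by (simp add: I_def)
        from \<psi>T[OF this] show "norm (\<psi> (x + y) - \<psi> x * \<psi> y) \<le> 0 + \<epsilon>" by (auto simp: T_def almost_character_def)
      qed
      then show ?thesis by simp
    qed
    show "norm (\<psi> x - 1) \<le> K * d x" for x
    proof (rule field_le_epsilon)
      fix \<epsilon> :: real assume "0 < \<epsilon>"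
      then have "({a, x}, \<epsilon>) \<in> I" by (simp add: I_def)
      from \<psi>T[OF this] show "norm (\<psi> x - 1) \<le> K * d x + \<epsilon>" by (auto simp: T_def almost_character_def)
    qed
    have "({a}, 1) \<in> I" by (simp add: I_def)
    from \<psi>T[OF this] have "c \<le> 1 - Re (\<psi> a)" by (auto simp: T_def almost_character_def)
    then show "\<psi> a \<noteq> 1" using c by auto
  qed
qed

end

section \<open>Finite coverings of compact spaces\<close>

lemma normal_space_compact_t2:
  assumes "compact (UNIV :: 'a::t2_space set)"
  shows "normal_space (euclidean :: 'a topology)"
proof (rule compact_Hausdorff_or_regular_imp_normal_space)
  show "compact_space (euclidean :: 'a topology)"
    using assms by (simp add: compact_space_def)
  have "Hausdorff_space (euclidean :: 'a topology)"
    unfolding Hausdorff_space_def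
  proof (intro allI impI)
    fix x y :: 'a
    assume "x \<in> topspace euclidean \<and> y \<in> topspace euclidean \<and> x \<noteq> y"
    then have "x \<noteq> y" by simp
    from hausdorff[OF this] obtain U V
      where "open U \<and> open V \<and> x \<in> U \<and> y \<in> V \<and> U \<inter> V = {}"
      by (elim exE)
    then show "\<exists>U V. openin euclidean U \<and> openin euclidean V \<and> x \<in> U \<and> y \<in> V \<and> disjnt U V"
      by (intro exI[of _ U] exI[of _ V]) (simp add: disjnt_def)
  qed
  then show "Hausdorff_space (euclidean :: 'a topology) \<or> regular_space (euclidean :: 'a topology)" ..
qed

lemma normal_compact_t2:
  fixes S T :: "'a::t2_space set"
  assumes "compact (UNIV :: 'a set)" "closed S" "closed T" "S \<inter> T = {}"
  obtains U V where "open U" "open V" "S \<subseteq> U" "T \<subseteq> V" "U \<inter> V = {}"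
proof -
  have "closedin euclidean S \<and> closedin euclidean T \<and> disjnt S T \<longrightarrow>
      (\<exists>U V. openin euclidean U \<and> openin euclidean V \<and> S \<subseteq> U \<and> T \<subseteq> V \<and> disjnt U V)"
    using normal_space_compact_t2[OF assms(1)] unfolding normal_space_def by (elim allE)
  then obtain U V where "open U \<and> open V \<and> S \<subseteq> U \<and> T \<subseteq> V \<and> U \<inter> V = {}"
    using assms(2-4) by (auto simp: disjnt_def)
  then show thesis using that by blast
qed

lemma Ex1_image_iff:
  assumes "inj_on f I"
  shows "(\<exists>!y. \<exists>i\<in>I. y = f i \<and> Q i) \<longleftrightarrow> (\<exists>!i. i \<in> I \<and> Q i)"
proof
  assume "\<exists>!y. \<exists>i\<in>I. y = f i \<and> Q i"
  then obtain i where i: "i \<in> I" "Q i" and u: "\<And>j. j \<in> I \<Longrightarrow> Q j \<Longrightarrow> f j = f i"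
    by (elim ex1E) blast
  show "\<exists>!i. i \<in> I \<and> Q i"
  proof (intro ex1I[of _ i] conjI i)
    fix j assume "j \<in> I \<and> Q j"
    then show "j = i"
      using u[of j] inj_onD[OF assms _ _ i(1), of j] by blast
  qed
next
  assume "\<exists>!i. i \<in> I \<and> Q i"
  then show "\<exists>!y. \<exists>i\<in>I. y = f i \<and> Q i" by (elim ex1E) blast
qed

lemma constant_if_locally:
  fixes P :: "'x::topological_space \<Rightarrow> 'c"
  assumes "connected (UNIV :: 'x set)"
  and loc: "\<And>x :: 'x. \<exists>S. open S \<and> x \<in> S \<and> (\<forall>y\<in>S. P y = P x)"
  shows "P x = P y"
proof -
  have op: "open (P -` R)" for R
  proof (subst open_subopen, rule ballI)
    fix z assume z: "z \<in> P -` R"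
    have "\<exists>S. open S \<and> z \<in> S \<and> (\<forall>y\<in>S. P y = P z)" by (rule loc)
    then obtain S where S: "open S \<and> z \<in> S \<and> (\<forall>y\<in>S. P y = P z)" by (rule exE)
    have "S \<subseteq> P -` R"
    proof
      fix y assume "y \<in> S"
      then have "P y = P z" using S by (metis (full_types))
      with z show "y \<in> P -` R" by (metis vimage_eq)
    qed
    then show "\<exists>T. open T \<and> z \<in> T \<and> T \<subseteq> P -` R" using S by (intro exI[of _ S] conjI) (elim conjE, assumption)+
  qed
  have "open (P -` {P x})" "open (P -` (- {P x}))"
    by (rule op)+
  then have "P -` {P x} = {} \<or> P -` (- {P x}) = {}"
    using connectedD[OF assms(1), of "P -` {P x}" "P -` (- {P x})"] by (simp add: vimage_Compl)
  moreover have "x \<in> P -` {P x}" by simp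
  ultimately have "y \<notin> P -` (- {P x})" by blast
  then show ?thesis by simp
qed

locale compact_covering =
  fixes p :: "'x::t2_space \<Rightarrow> 'y::t2_space" and k :: nat
  assumes covering: "fold_covering k p"
    and compact_base: "compact (UNIV :: 'y set)"
begin

lemma continuous_p: "continuous_on UNIV p"
  using covering by (simp add: fold_covering_def)

lemma surj_p: "surj p"
  using covering by (simp add: fold_covering_def)

definition sheets :: "'y set \<Rightarrow> (nat \<Rightarrow> 'x set) \<Rightarrow> (nat \<Rightarrow> 'y \<Rightarrow> 'x) \<Rightarrow> bool"
  where "sheets W V q \<longleftrightarrow> open W \<and> p -` W = (\<Union>i\<in>{1..k}. V i) \<and> disjoint_family_on V {1..k} \<and>
    (\<forall>i\<in>{1..k}. open (V i) \<and> homeomorphism (V i) W p (q i))"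

lemma even_cover:
  obtains W V q where "sheets W V q" "y \<in> W"
proof -
  obtain W and V :: "nat \<Rightarrow> 'x set" where W: "open W" "y \<in> W"
    and cover: "p -` W = (\<Union>i\<in>{1..k}. V i)" and disj: "disjoint_family_on V {1..k}"
    and V: "\<forall>i\<in>{1..k}. open (V i) \<and> (\<exists>q. homeomorphism (V i) W p q)"
    using covering unfolding fold_covering_def by meson
  then have "\<forall>i\<in>{1..k}. \<exists>q. homeomorphism (V i) W p q" by blast
  then obtain q where "\<forall>i\<in>{1..k}. homeomorphism (V i) W p (q i)"
    by (rule bchoice[THEN exE])
  with W cover disj V have "sheets W V q" by (simp add: sheets_def)
  then show thesis using W that by blast
qed

lemma sheetsD:
  assumes "sheets W V q"
  shows "open W"
    and "\<And>i. i \<in> {1..k} \<Longrightarrow> open (V i)"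
    and "\<And>i. i \<in> {1..k} \<Longrightarrow> continuous_on W (q i)"
    and "\<And>i w. i \<in> {1..k} \<Longrightarrow> w \<in> W \<Longrightarrow> q i w \<in> V i \<and> p (q i w) = w"
    and "\<And>x. p x \<in> W \<Longrightarrow> \<exists>i\<in>{1..k}. x \<in> V i"
    and "\<And>i x. i \<in> {1..k} \<Longrightarrow> x \<in> V i \<Longrightarrow> p x \<in> W \<and> q i (p x) = x"
    and "\<And>i j x. i \<in> {1..k} \<Longrightarrow> j \<in> {1..k} \<Longrightarrow> x \<in> V i \<Longrightarrow> x \<in> V j \<Longrightarrow> i = j"
proof -
  have h: "homeomorphism (V i) W p (q i)" if "i \<in> {1..k}" for i
    using assms that by (simp add: sheets_def)
  show "open W" "\<And>i. i \<in> {1..k} \<Longrightarrow> open (V i)"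
    using assms by (auto simp: sheets_def)
  show "continuous_on W (q i)" if "i \<in> {1..k}" for i
    using h[OF that] by (simp add: homeomorphism_def)
  show "q i w \<in> V i \<and> p (q i w) = w" if "i \<in> {1..k}" "w \<in> W" for i w
    using h[OF that(1)] that(2) unfolding homeomorphism_def by blast
  show "\<exists>i\<in>{1..k}. x \<in> V i" if "p x \<in> W" for x
    using that assms unfolding sheets_def by blast
  show "p x \<in> W \<and> q i (p x) = x" if "i \<in> {1..k}" "x \<in> V i" for i x
    using h[OF that(1)] that(2) unfolding homeomorphism_def by blast
  show "i = j" if "i \<in> {1..k}" "j \<in> {1..k}" "x \<in> V i" "x \<in> V j" for i j x
    using assms that unfolding sheets_def disjoint_family_on_def by blast
qed

lemma sheet:
  obtains V W q where "open V" "x \<in> V" "open W" "homeomorphism V W p q"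
proof -
  obtain W V q where sh: "sheets W V q" and W: "p x \<in> W"
    by (rule even_cover)
  from sheetsD(5)[OF sh W] obtain i where i: "i \<in> {1..k}" "x \<in> V i" by blast
  show thesis
    by (rule that[of "V i" W "q i"]) (use sh i in \<open>auto simp: sheets_def\<close>)
qed

lemma sheet_inj:
  obtains V where "open V" "x \<in> V" "inj_on p V"
proof -
  obtain V W q where s: "open V" "x \<in> V" "homeomorphism V W p q"
    by (rule sheet)
  then have "inj_on p V"
    unfolding homeomorphism_def by (metis inj_onI)
  then show thesis using that s by blast
qed

lemma open_map_p:
  assumes "open S"
  shows "open (p ` S)"
proof (subst open_subopen, rule ballI)
  fix y assume "y \<in> p ` S"
  then obtain x where x: "x \<in> S" "y = p x" by blast
  obtain V W q where s: "open V" "x \<in> V" "open W" "homeomorphism V W p q"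
    by (rule sheet)
  have "openin (top_of_set V) (V \<inter> S)"
    using assms by (simp add: openin_open_Int)
  from homeomorphism_imp_open_map[OF s(4) this] have "open (p ` (V \<inter> S))"
    using s(3) openin_open_trans by blast
  then show "\<exists>T. open T \<and> y \<in> T \<and> T \<subseteq> p ` S"
    using x s(2) by blast
qed

lemma finite_fibre: "finite (p -` {y})" and card_fibre: "card (p -` {y}) = k"
proof -
  obtain W V q where sh: "sheets W V q" and W: "y \<in> W"
    by (rule even_cover)
  note e = sheetsD[OF sh]
  have "bij_betw (\<lambda>i. q i y) {1..k} (p -` {y})"
    unfolding bij_betw_def
  proof
    show "inj_on (\<lambda>i. q i y) {1..k}"
    proof (rule inj_onI)
      fix i j assume ij: "i \<in> {1..k}" "j \<in> {1..k}" "q i y = q j y"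
      then show "i = j"
        using e(7)[OF ij(1,2), of "q i y"] e(4)[OF ij(1) W] e(4)[OF ij(2) W] by simp
    qed
    show "(\<lambda>i. q i y) ` {1..k} = p -` {y}"
    proof
      show "(\<lambda>i. q i y) ` {1..k} \<subseteq> p -` {y}"
        using e(4)[OF _ W] by auto
      show "p -` {y} \<subseteq> (\<lambda>i. q i y) ` {1..k}"
      proof
        fix x assume x: "x \<in> p -` {y}"
        with W e(5)[of x] obtain i where "i \<in> {1..k}" "x \<in> V i" by auto
        with e(6)[of i x] x show "x \<in> (\<lambda>i. q i y) ` {1..k}" by force
      qed
    qed
  qed
  then show "finite (p -` {y})" "card (p -` {y}) = k"
    using bij_betw_finite bij_betw_same_card by fastforce+
qed

text \<open>The map \<open>p\<close> is closed: each sheet over a neighbourhood of \<open>y\<close> meets \<open>S\<close> in an open set with an open image, and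
over the intersection of the finitely many images every sheet lies in \<open>S\<close>.\<close>

lemma tube:
  assumes "open S" "p -` {y} \<subseteq> S"
  obtains T where "open T" "y \<in> T" "p -` T \<subseteq> S"
proof -
  obtain W V q where sh: "sheets W V q" and W: "y \<in> W"
    by (rule even_cover)
  note e = sheetsD[OF sh]
  show thesis
  proof (rule that[of "W \<inter> (\<Inter>i\<in>{1..k}. p ` (V i \<inter> S))"])
    show "open (W \<inter> (\<Inter>i\<in>{1..k}. p ` (V i \<inter> S)))"
      using e(1,2) assms(1) by (intro open_Int open_INT ballI open_map_p) auto
    show "y \<in> W \<inter> (\<Inter>i\<in>{1..k}. p ` (V i \<inter> S))"
    proof (intro IntI W INT_I)
      fix i assume "i \<in> {1..k}"
      from e(4)[OF this W] assms(2) show "y \<in> p ` (V i \<inter> S)"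
        by (metis IntI image_eqI subsetD vimage_singleton_eq)
    qed
    show "p -` (W \<inter> (\<Inter>i\<in>{1..k}. p ` (V i \<inter> S))) \<subseteq> S"
    proof
      fix x assume x: "x \<in> p -` (W \<inter> (\<Inter>i\<in>{1..k}. p ` (V i \<inter> S)))"
      then obtain i where i: "i \<in> {1..k}" "x \<in> V i" using e(5)[of x] by blast
      with x obtain x' where x': "x' \<in> V i \<inter> S" "p x = p x'" by blast
      then have "x = x'" using e(6)[OF i(1)] i(2) by (metis IntD1)
      with x' show "x \<in> S" by simp
    qed
  qed
qed

lemma compact_total: "compact (UNIV :: 'x set)"
proof (rule compactI)
  fix \<C> :: "'x set set"
  assume \<C>: "\<forall>S\<in>\<C>. open S" "UNIV \<subseteq> \<Union>\<C>"
  have "\<exists>\<D> T. \<D> \<subseteq> \<C> \<and> finite \<D> \<and> open T \<and> y \<in> T \<and> p -` T \<subseteq> \<Union>\<D>" for y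
  proof -
    have "p -` {y} \<subseteq> \<Union>\<C>" using \<C>(2) by blast
    from finite_subset_Union[OF finite_fibre this]
    obtain \<D> where \<D>: "finite \<D>" "\<D> \<subseteq> \<C>" "p -` {y} \<subseteq> \<Union>\<D>" .
    have "open (\<Union>\<D>)" using \<C>(1) \<D>(2) by blast
    from tube[OF this \<D>(3)] obtain T where "open T" "y \<in> T" "p -` T \<subseteq> \<Union>\<D>" .
    with \<D> show ?thesis by blast
  qed
  then obtain \<D> T where \<D>: "\<And>y. \<D> y \<subseteq> \<C>" "\<And>y. finite (\<D> y)"
    and T: "\<And>y. open (T y)" "\<And>y. y \<in> T y" "\<And>y. p -` T y \<subseteq> \<Union>(\<D> y)"
    by metis
  have "(UNIV :: 'y set) \<subseteq> (\<Union>y\<in>UNIV. T y)" using T(2) by blast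
  then obtain I where I: "finite I" "UNIV \<subseteq> (\<Union>y\<in>I. T y)"
    by (rule compactE_image[OF compact_base T(1)])
  have "UNIV \<subseteq> \<Union>(\<Union>y\<in>I. \<D> y)"
  proof
    fix x :: 'x
    obtain y where "y \<in> I" "p x \<in> T y" using I by blast
    then show "x \<in> \<Union>(\<Union>y\<in>I. \<D> y)" using T(3)[of y] by blast
  qed
  moreover have "finite (\<Union>y\<in>I. \<D> y)" "(\<Union>y\<in>I. \<D> y) \<subseteq> \<C>" using I \<D> by auto
  ultimately show "\<exists>\<D>\<subseteq>\<C>. finite \<D> \<and> UNIV \<subseteq> \<Union>\<D>" by blast
qed

text \<open>The fibre product of \<open>p\<close> with itself is the union of the diagonal and the set of pairs of distinct points in one
fibre. The latter is closed since \<open>p\<close> is locally injective, so normality of the compact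
square separates the two.\<close>

lemma separate_diagonal:
  obtains A B where "open A" "open B" "A \<inter> B = {}" "\<And>x. (x, x) \<in> A"
    "\<And>x y. p x = p y \<Longrightarrow> x \<noteq> y \<Longrightarrow> (x, y) \<in> B"
proof -
  let ?D = "{z :: 'x \<times> 'x. fst z = snd z}"
  let ?Z = "{z :: 'x \<times> 'x. p (fst z) = p (snd z) \<and> fst z \<noteq> snd z}"
  have pf: "continuous_on UNIV (\<lambda>z :: 'x \<times> 'x. p (fst z))" "continuous_on UNIV (\<lambda>z :: 'x \<times> 'x. p (snd z))"
    by (auto intro!: continuous_on_compose2[OF continuous_p] continuous_intros)
  obtain V where V: "\<And>x. open (V x)" "\<And>x. x \<in> V x"
    "\<And>x. inj_on p (V x)"
  proof -
    have "\<exists>V. open V \<and> x \<in> V \<and> inj_on p V" for x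
      by (rule sheet_inj[of x]) blast
    then show thesis using that by metis
  qed
  have D: "closed ?D"
    by (intro closed_Collect_eq continuous_intros)
  have Z: "closed ?Z"
  proof -
    have "- ?Z = {z. p (fst z) \<noteq> p (snd z)} \<union> (\<Union>x. V x \<times> V x)"
      using V(2,3) by (fastforce dest: inj_onD)
    moreover have "open \<dots>"
      using V(1) by (intro open_Un open_UN ballI open_Times open_Collect_neq pf) auto
    ultimately show ?thesis by (simp add: closed_def)
  qed
  have "?D \<inter> ?Z = {}" by auto
  moreover have "compact (UNIV :: ('x \<times> 'x) set)"
    using compact_Times[OF compact_total compact_total] by simp
  ultimately obtain A B where "open A" "open B" "?D \<subseteq> A" "?Z \<subseteq> B" "A \<inter> B = {}"
    using normal_compact_t2[OF _ D Z] by blast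
  then show thesis
    by (intro that[of A B]) (auto simp: subset_iff)
qed

end

section \<open>Lifts of small translations\<close>

locale compact_group_covering = compact_covering p k
  for p :: "'x::t2_space \<Rightarrow> 'g::{topological_ab_group_add, t2_space}" and k +
  assumes connected_total: "connected (UNIV :: 'x set)"
begin

text \<open>Two lifts of the same map agree on a closed set as the total space is Hausdorff, and on an open set as
\<open>p\<close> is locally injective.\<close>

lemma unique_lift:
  fixes f g :: "'x \<Rightarrow> 'x"
  assumes f: "continuous_on UNIV f" and g: "continuous_on UNIV g"
    and pfg: "\<And>x. p (f x) = p (g x)" and x0: "f x0 = g x0"
  shows "f x = g x"
proof -
  have "\<exists>S. open S \<and> x \<in> S \<and> (\<forall>y\<in>S. (f y = g y) = (f x = g x))" for x
  proof (cases "f x = g x")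
    case True
    obtain V where V: "open V" "f x \<in> V" "inj_on p V"
      by (rule sheet_inj)
    have "open (f -` V \<inter> g -` V)"
      using f g V(1) by (simp add: continuous_on_open_vimage open_Int)
    moreover have "f y = g y" if "y \<in> f -` V \<inter> g -` V" for y
      using that by (intro inj_onD[OF V(3) pfg]) blast+
    moreover have "x \<in> f -` V \<inter> g -` V"
      using V(2) True by simp
    ultimately show ?thesis
      using True by blast
  next
    case False
    then show ?thesis
      using open_Collect_neq[OF f g] by (intro exI[of _ "{x. f x \<noteq> g x}"]) auto
  qed
  from constant_if_locally[OF connected_total, of "\<lambda>x. f x = g x", OF this] x0 show ?thesis by blast
qed

text \<open>Translations of the base by small elements lift to the total space. For small \<open>u\<close>, every pair \<open>(x, y)\<close>
with \<open>p y = p x + u\<close> lies in one of the two open sets \<open>A\<close> and \<open>B\<close> that separate the diagonal from the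
other pairs of points in a common fibre, because the remaining pairs form a compact set. The points \<open>y\<close> with \<open>(x, y) \<in> A\<close> vary
continuously with \<open>x\<close> and \<open>u\<close>, and whether there is exactly one of them is locally constant. This is so
at \<open>(x0, 0)\<close>, hence at \<open>(x0, u)\<close> for a fixed \<open>x0\<close> and all small \<open>u\<close>, and then at \<open>(x, u)\<close> for
all \<open>x\<close> by connectedness.\<close>

lemma small_shifts:
  obtains U \<sigma> where "open U" "0 \<in> U"
    "\<And>u x. u \<in> U \<Longrightarrow> p (\<sigma> u x) = p x + u"
    "continuous_on (UNIV \<times> U) (\<lambda>(x, u). \<sigma> u x)"
    "\<And>x. \<sigma> 0 x = x"
proof -
  obtain A B where A: "open A" and B: "open B" and AB: "A \<inter> B = {}" and diag: "\<And>x. (x, x) \<in> A"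
    and off: "\<And>x y. p x = p y \<Longrightarrow> x \<noteq> y \<Longrightarrow> (x, y) \<in> B"
    using separate_diagonal by metis
  define N where "N z y \<longleftrightarrow> p y = p (fst z) + snd z \<and> (fst z, y) \<in> A" for z y
  define U0 where "U0 = - (\<lambda>z. p (snd z) - p (fst z)) ` (- (A \<union> B))"
  have cont: "continuous_on UNIV (\<lambda>z :: 'x \<times> 'x. p (snd z) - p (fst z))"
    by (intro continuous_intros continuous_on_compose2[OF continuous_p]) auto
  have "compact (UNIV :: ('x \<times> 'x) set)"
    using compact_Times[OF compact_total compact_total] by simp
  then have "compact (- (A \<union> B))"
    using A B by (metis Compl_eq_Diff_UNIV compact_diff open_Un)
  then have U0: "open U0"
    unfolding U0_def
    by (metis cont compact_continuous_image compact_imp_closed continuous_on_subset open_Compl subset_UNIV)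
  have "0 \<in> U0"
  proof (rule ccontr)
    assume "0 \<notin> U0"
    then obtain z where z: "z \<notin> A \<union> B" "p (snd z) - p (fst z) = 0"
      unfolding U0_def by force
    then show False
      using diag[of "fst z"] off[of "fst z" "snd z"] by (cases z) auto
  qed
  have AorB: "(x, y) \<in> A \<union> B" if "p y = p x + u" "u \<in> U0" for x y u
    using that unfolding U0_def by force
  define E where "E z \<longleftrightarrow> (\<exists>!y. N z y)" for z
  have local: "\<exists>S. open S \<and> z1 \<in> S \<and> S \<subseteq> UNIV \<times> U0 \<and> (\<forall>z\<in>S. E z = E z1) \<and>
      (E z1 \<longrightarrow> (\<exists>s. continuous_on S s \<and> (\<forall>z\<in>S. N z (s z))))"
    if z1: "z1 \<in> UNIV \<times> U0" for z1
  proof -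
    define g where "g z = p (fst z) + snd z" for z :: "'x \<times> 'g"
    have g: "continuous_on UNIV g"
      unfolding g_def by (intro continuous_intros continuous_on_compose2[OF continuous_p]) auto
    obtain W V q where sh: "sheets W V q" and W: "g z1 \<in> W"
      by (rule even_cover)
    note e = sheetsD[OF sh]
    define S0 where "S0 = (UNIV \<times> U0) \<inter> g -` W"
    define h where "h i z = (fst z, q i (g z))" for i z
    have "open (g -` W)"
      using g e(1) by (simp add: continuous_on_open_vimage)
    then have S0: "open S0" "z1 \<in> S0"
      using U0 z1 W by (auto simp: S0_def open_Times)
    have qg: "continuous_on S0 (\<lambda>z. q i (g z))" if "i \<in> {1..k}" for i
      using e(3)[OF that] by (rule continuous_on_compose2)
        (auto simp: S0_def intro: continuous_on_subset[OF g])
    have h: "continuous_on S0 (h i)" if "i \<in> {1..k}" for i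
      unfolding h_def by (intro continuous_intros qg that)
    \<comment> \<open>The \<open>i\<close>-th candidate stays on its side of the separation near \<open>z1\<close>.\<close>
    define C where "C i = (if h i z1 \<in> A then A else B)" for i
    define S where "S = S0 \<inter> (\<Inter>i\<in>{1..k}. h i -` C i \<inter> S0)"
    have "open (h i -` C i \<inter> S0)" if "i \<in> {1..k}" for i
      using h[OF that] S0(1) A B by (auto simp: C_def continuous_on_open_vimage)
    then have "open S"
      unfolding S_def using S0 by (intro open_Int open_INT) auto
    have "h i z1 \<in> C i" if "i \<in> {1..k}" for i
    proof -
      have "p (q i (g z1)) = p (fst z1) + snd z1"
        using e(4)[OF that W] by (simp add: g_def)
      then show ?thesis
        using AorB[of "q i (g z1)" "fst z1" "snd z1"] z1 by (auto simp: C_def h_def)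
    qed
    then have "z1 \<in> S" using S0 by (auto simp: S_def)
    have hA: "h i z \<in> A \<longleftrightarrow> h i z1 \<in> A" if "z \<in> S" "i \<in> {1..k}" for z i
      using that AB by (auto simp: S_def C_def split: if_splits)
    have N_iff: "N z y \<longleftrightarrow> (\<exists>i\<in>{1..k}. y = q i (g z) \<and> h i z \<in> A)" if z: "z \<in> S" for z y
    proof -
      have gz: "g z \<in> W" using z by (auto simp: S_def S0_def)
      show ?thesis
      proof
        assume N: "N z y"
        then have "p y = g z" by (simp add: N_def g_def)
        with gz e(5)[of y] obtain i where i: "i \<in> {1..k}" "y \<in> V i" by auto
        then have "y = q i (g z)" using e(6)[OF i] \<open>p y = g z\<close> by simp
        with N i show "\<exists>i\<in>{1..k}. y = q i (g z) \<and> h i z \<in> A"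
          by (auto simp: N_def h_def)
      next
        assume "\<exists>i\<in>{1..k}. y = q i (g z) \<and> h i z \<in> A"
        then show "N z y" using e(4)[OF _ gz] by (auto simp: N_def h_def g_def)
      qed
    qed
    have q_inj: "i = j" if "z \<in> S" "i \<in> {1..k}" "j \<in> {1..k}" "q i (g z) = q j (g z)" for i j z
    proof -
      have "g z \<in> W" using that by (auto simp: S_def S0_def)
      then show ?thesis using e(4)[OF that(2)] e(4)[OF that(3)] e(7)[OF that(2,3)] that(4) by metis
    qed
    have ex1_iff: "E z \<longleftrightarrow> (\<exists>!i. i \<in> {1..k} \<and> h i z1 \<in> A)" if z: "z \<in> S" for z
    proof -
      have "N z y \<longleftrightarrow> (\<exists>i\<in>{1..k}. y = q i (g z) \<and> h i z1 \<in> A)" for y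
        using N_iff[OF z, of y] hA[OF z] by blast
      then have "N z = (\<lambda>y. \<exists>i\<in>{1..k}. y = q i (g z) \<and> h i z1 \<in> A)"
        by (rule ext)
      moreover have "inj_on (\<lambda>i. q i (g z)) {1..k}"
        by (rule inj_onI) (rule q_inj[OF z])
      ultimately show ?thesis
        unfolding E_def
        using Ex1_image_iff[of "\<lambda>i. q i (g z)" "{1..k}" "\<lambda>i. h i z1 \<in> A"] by simp
    qed
    have "E z1 \<longrightarrow> (\<exists>s. continuous_on S s \<and> (\<forall>z\<in>S. N z (s z)))"
    proof
      assume ex1: "E z1"
      obtain i where i: "i \<in> {1..k}" "h i z1 \<in> A"
        using ex1 ex1_iff[OF \<open>z1 \<in> S\<close>] by blast
      have "continuous_on S (\<lambda>z. q i (g z))"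
        by (rule continuous_on_subset[OF qg[OF i(1)]]) (auto simp: S_def)
      moreover have "N z (q i (g z))" if "z \<in> S" for z
        using N_iff[OF that] hA[OF that i(1)] i by blast
      ultimately show "\<exists>s. continuous_on S s \<and> (\<forall>z\<in>S. N z (s z))" by blast
    qed
    moreover have "\<forall>z\<in>S. E z = E z1"
      using ex1_iff ex1_iff[OF \<open>z1 \<in> S\<close>] by blast
    moreover have "S \<subseteq> UNIV \<times> U0" by (auto simp: S_def S0_def)
    ultimately show ?thesis using \<open>open S\<close> \<open>z1 \<in> S\<close>
      by (intro exI[of _ S] conjI)
  qed
  have N0: "N (x, 0) y \<longleftrightarrow> y = x" for x y
    using diag off AB by (auto simp: N_def)
  define x0 :: 'x where "x0 = undefined"
  define U where "U = {u \<in> U0. E (x0, u)}"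
  have "0 \<in> U"
  proof -
    have "E (x0, 0)"
      unfolding E_def by (rule ex1I[of _ x0]) (simp_all add: N0)
    then show ?thesis using \<open>0 \<in> U0\<close> by (simp add: U_def)
  qed
  have box: "\<exists>S1 S2. open S1 \<and> open S2 \<and> x \<in> S1 \<and> u \<in> S2 \<and> S2 \<subseteq> U0 \<and>
      (\<forall>y\<in>S1. \<forall>v\<in>S2. E (y, v) = E (x, u))" if "u \<in> U0" for x u
  proof -
    have "(x, u) \<in> UNIV \<times> U0" using that by simp
    from local[OF this] obtain S where S: "open S" "(x, u) \<in> S" "S \<subseteq> UNIV \<times> U0"
      "\<forall>z\<in>S. E z = E (x, u)" by (elim exE conjE)
    obtain S1 S2 where "open S1" "open S2" "(x, u) \<in> S1 \<times> S2" "S1 \<times> S2 \<subseteq> S"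
      using open_prod_elim[OF S(1,2)] .
    then show ?thesis
      using S(3,4) by (intro exI[of _ S1] exI[of _ S2]) blast
  qed
  have "open U"
  proof (subst open_subopen, rule ballI)
    fix u assume u: "u \<in> U"
    then have "u \<in> U0" "E (x0, u)" by (simp_all add: U_def)
    with box[of u x0] obtain S2 where "open S2" "u \<in> S2" "S2 \<subseteq> U0" "\<forall>v\<in>S2. E (x0, v)"
      by blast
    then show "\<exists>T. open T \<and> u \<in> T \<and> T \<subseteq> U"
      by (intro exI[of _ S2]) (auto simp: U_def)
  qed
  have E: "E (x, u)" if u: "u \<in> U" for x u
  proof -
    have "\<exists>S. open S \<and> x \<in> S \<and> (\<forall>y\<in>S. E (y, u) = E (x, u))" for x
      using box[of u x] u unfolding U_def by blast
    from constant_if_locally[OF connected_total, of "\<lambda>x. E (x, u)", OF this, of x x0] u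
    show ?thesis by (simp add: U_def)
  qed
  then have unique: "\<exists>!y. N (x, u) y" if u: "u \<in> U" for x u
    using that by (simp add: E_def)
  define \<sigma> where "\<sigma> u x = (THE y. N (x, u) y)" for u x
  have \<sigma>: "N (x, u) (\<sigma> u x)" if "u \<in> U" for x u
    unfolding \<sigma>_def by (rule theI'[OF unique[OF that]])
  have \<sigma>_eq: "\<sigma> u x = y" if "u \<in> U" "N (x, u) y" for u x y
    using unique[OF that(1), of x] \<sigma>[OF that(1), of x] that(2) by blast
  show thesis
  proof (rule that[of U \<sigma>])
    show "p (\<sigma> u x) = p x + u" if "u \<in> U" for u x
      using \<sigma>[OF that, of x] by (simp add: N_def)
    show "\<sigma> 0 x = x" for x
      using \<sigma>[OF \<open>0 \<in> U\<close>, of x] by (simp add: N0)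
    have "open (UNIV \<times> U :: ('x \<times> 'g) set)"
      using \<open>open U\<close> by (simp add: open_Times)
    moreover have "isCont (\<lambda>(x, u). \<sigma> u x) z" if z: "z \<in> UNIV \<times> U" for z
    proof -
      have z0: "z \<in> UNIV \<times> U0" "E z"
        using z E[of "snd z" "fst z"] by (auto simp: U_def)
      from local[OF z0(1)] obtain S where S: "open S" "z \<in> S"
        and "E z \<longrightarrow> (\<exists>s. continuous_on S s \<and> (\<forall>z\<in>S. N z (s z)))"
        by (elim exE conjE)
      with z0(2) obtain s where s: "continuous_on S s" "\<forall>z\<in>S. N z (s z)" by blast
      have "open (S \<inter> UNIV \<times> U)"
        using S(1) \<open>open (UNIV \<times> U)\<close> by blast
      moreover have "continuous_on (S \<inter> UNIV \<times> U) s"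
        using s(1) by (rule continuous_on_subset) blast
      moreover have "(\<lambda>(x, u). \<sigma> u x) w = s w" if "w \<in> S \<inter> UNIV \<times> U" for w
        using that s(2) \<sigma>_eq[of "snd w" "fst w" "s w"] by (auto simp: case_prod_unfold)
      ultimately have "continuous_on (S \<inter> UNIV \<times> U) (\<lambda>(x, u). \<sigma> u x)"
        by (metis (no_types, lifting) continuous_on_cong)
      then show ?thesis
        using \<open>open (S \<inter> UNIV \<times> U)\<close> S(2) z by (simp add: continuous_on_eq_continuous_at)
    qed
    ultimately show "continuous_on (UNIV \<times> U) (\<lambda>(x, u). \<sigma> u x)"
      by (simp add: continuous_on_eq_continuous_at)
  qed (use \<open>open U\<close> \<open>0 \<in> U\<close> in auto)
qed

end

context compact_group_covering
begin

text \<open>The maps \<open>\<sigma> u \<circ> \<sigma> v\<close> and \<open>\<sigma> v \<circ> \<sigma> u\<close> lift the same translation, and so do \<open>\<sigma> (- u) \<circ> \<sigma> u\<close> and the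
identity. For small \<open>u\<close> and \<open>v\<close> they send \<open>x0\<close> into one sheet, so they agree there, and
everywhere by uniqueness of lifts.\<close>

lemma commuting_shifts:
  obtains U \<sigma> where "open U" "0 \<in> U"
    "\<And>u x. u \<in> U \<Longrightarrow> p (\<sigma> u x) = p x + u"
    "continuous_on (UNIV \<times> U) (\<lambda>(x, u). \<sigma> u x)"
    "\<And>x. \<sigma> 0 x = x"
    "\<And>u v x. u \<in> U \<Longrightarrow> v \<in> U \<Longrightarrow> \<sigma> u (\<sigma> v x) = \<sigma> v (\<sigma> u x)"
    "\<And>u. u \<in> U \<Longrightarrow> - u \<in> U"
    "\<And>u x. u \<in> U \<Longrightarrow> \<sigma> (- u) (\<sigma> u x) = x"
proof -
  obtain U \<sigma> where U: "open U" "0 \<in> U" and lift: "\<And>u x. u \<in> U \<Longrightarrow> p (\<sigma> u x) = p x + u"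
    and cont: "continuous_on (UNIV \<times> U) (\<lambda>(x, u). \<sigma> u x)" and zero: "\<And>x. \<sigma> 0 x = x"
    using small_shifts by blast
  have cont1: "continuous_on UNIV (\<sigma> u)" if "u \<in> U" for u
  proof -
    have "continuous_on UNIV (\<lambda>x. (\<lambda>(x, u). \<sigma> u x) (x, u))"
      by (rule continuous_on_compose2[OF cont]) (use that in \<open>auto intro!: continuous_intros\<close>)
    then show ?thesis by simp
  qed
  define x0 :: 'x where "x0 = undefined"
  obtain V where V: "open V" "x0 \<in> V" "inj_on p V"
    by (rule sheet_inj)
  let ?two = "\<lambda>(u, v). \<sigma> u (\<sigma> v x0)"
  have "continuous_on (U \<times> U) (\<lambda>w. (\<lambda>(x, u). \<sigma> u x) (x0, snd w))"
    by (rule continuous_on_compose2[OF cont]) (auto intro!: continuous_intros)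
  then have "continuous_on (U \<times> U) (\<lambda>w. \<sigma> (snd w) x0)" by simp
  then have "continuous_on (U \<times> U) (\<lambda>w. (\<lambda>(x, u). \<sigma> u x) (\<sigma> (snd w) x0, fst w))"
    by (intro continuous_on_compose2[OF cont] continuous_intros) auto
  then have "continuous_on (U \<times> U) ?two"
    by (simp add: case_prod_unfold)
  then have "open (?two -` V \<inter> U \<times> U)"
    using U(1) V(1) by (simp add: continuous_on_open_vimage open_Times)
  moreover have "(0, 0) \<in> ?two -` V \<inter> U \<times> U"
    using U(2) V(2) by (simp add: zero)
  ultimately obtain S1 S2 where S: "open S1" "open S2" "(0, 0) \<in> S1 \<times> S2"
    "S1 \<times> S2 \<subseteq> ?two -` V \<inter> U \<times> U"
    by (rule open_prod_elim)
  define U1 where "U1 = S1 \<inter> S2 \<inter> uminus -` (S1 \<inter> S2)"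
  have "open (uminus -` (S1 \<inter> S2))"
    using S(1,2) by (intro open_vimage open_Int continuous_intros)
  then have "open U1"
    unfolding U1_def using S by blast
  have "0 \<in> U1" using S(3) by (simp add: U1_def)
  have U1U: "u \<in> U" if "u \<in> U1" for u
  proof -
    have "(u, 0) \<in> S1 \<times> S2" using that S(3) by (simp add: U1_def)
    from subsetD[OF S(4) this] show ?thesis by simp
  qed
  have near: "\<sigma> u (\<sigma> v x0) \<in> V" if "u \<in> U1" "v \<in> U1" for u v
  proof -
    have "(u, v) \<in> S1 \<times> S2" using that by (simp add: U1_def)
    from subsetD[OF S(4) this] show ?thesis by simp
  qed
  have minus: "- u \<in> U1" if "u \<in> U1" for u
    using that by (simp add: U1_def)
  have cont2: "continuous_on UNIV (\<lambda>x. \<sigma> u (\<sigma> v x))" if "u \<in> U1" "v \<in> U1" for u v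
    by (rule continuous_on_compose2[OF cont1[OF U1U[OF that(1)]] cont1[OF U1U[OF that(2)]]]) simp
  show thesis
  proof (rule that[of U1 \<sigma>])
    show "continuous_on (UNIV \<times> U1) (\<lambda>(x, u). \<sigma> u x)"
      by (rule continuous_on_subset[OF cont]) (use U1U in blast)
    show "\<sigma> u (\<sigma> v x) = \<sigma> v (\<sigma> u x)" if "u \<in> U1" "v \<in> U1" for u v x
    proof (rule unique_lift[where f = "\<lambda>x. \<sigma> u (\<sigma> v x)" and g = "\<lambda>x. \<sigma> v (\<sigma> u x)"])
      show "p (\<sigma> u (\<sigma> v y)) = p (\<sigma> v (\<sigma> u y))" for y
        using lift[OF U1U[OF that(1)]] lift[OF U1U[OF that(2)]] by (simp add: add.assoc add.commute)
      then show "\<sigma> u (\<sigma> v x0) = \<sigma> v (\<sigma> u x0)"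
        by (rule inj_onD[OF V(3) _ near[OF that] near[OF that(2,1)]])
    qed (intro cont2 that)+
    show "\<sigma> (- u) (\<sigma> u x) = x" if "u \<in> U1" for u x
    proof (rule unique_lift[where f = "\<lambda>x. \<sigma> (- u) (\<sigma> u x)" and g = "\<lambda>x. x"])
      have mu: "- u \<in> U1" by (rule minus[OF that])
      show "p (\<sigma> (- u) (\<sigma> u y)) = p y" for y
        using lift[OF U1U[OF mu], of "\<sigma> u y"] lift[OF U1U[OF that], of y] by simp
      then show "\<sigma> (- u) (\<sigma> u x0) = x0"
        by (rule inj_onD[OF V(3) _ near[OF mu that] V(2)])
    qed (intro cont2 that minus continuous_on_id)+
  qed (use \<open>open U1\<close> \<open>0 \<in> U1\<close> lift U1U zero minus in auto)
qed

end

section \<open>The abelian group generated by the lifts\<close>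

locale shift_family = compact_group_covering p k
  for p :: "'x::t2_space \<Rightarrow> 'g::{topological_ab_group_add, t2_space}" and k +
  fixes U :: "'g set" and \<sigma> :: "'g \<Rightarrow> 'x \<Rightarrow> 'x"
  assumes open_U: "open U" and zero_U: "0 \<in> U"
    and p_shift: "\<And>u x. u \<in> U \<Longrightarrow> p (\<sigma> u x) = p x + u"
    and continuous_shift2: "continuous_on (UNIV \<times> U) (\<lambda>(x, u). \<sigma> u x)"
    and shift_0: "\<And>x. \<sigma> 0 x = x"
    and shift_commute: "\<And>u v x. u \<in> U \<Longrightarrow> v \<in> U \<Longrightarrow> \<sigma> u (\<sigma> v x) = \<sigma> v (\<sigma> u x)"
    and uminus_U: "\<And>u. u \<in> U \<Longrightarrow> - u \<in> U"
    and shift_uminus: "\<And>u x. u \<in> U \<Longrightarrow> \<sigma> (- u) (\<sigma> u x) = x"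
begin

lemma continuous_shift: "u \<in> U \<Longrightarrow> continuous_on UNIV (\<sigma> u)"
proof -
  assume u: "u \<in> U"
  have "continuous_on UNIV (\<lambda>x. (\<lambda>(x, u). \<sigma> u x) (x, u))"
    by (rule continuous_on_compose2[OF continuous_shift2]) (use u in \<open>auto intro!: continuous_intros\<close>)
  then show ?thesis by simp
qed

text \<open>Inside a sheet around \<open>y\<close>, a point \<open>z\<close> is determined by \<open>p z\<close>, so it is the shift of \<open>y\<close> by \<open>p z - p y\<close>.\<close>

lemma shift_nbhd:
  assumes T: "open T" "0 \<in> T" "T \<subseteq> U"
  obtains S where "open S" "y \<in> S" "\<forall>z\<in>S. \<exists>u\<in>T. z = \<sigma> u y"
proof -
  obtain V where V: "open V" "y \<in> V" "inj_on p V"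
    by (rule sheet_inj)
  have "continuous_on T (\<lambda>u. (\<lambda>(x, u). \<sigma> u x) (y, u))"
    by (rule continuous_on_compose2[OF continuous_shift2]) (use T in \<open>auto intro!: continuous_intros\<close>)
  then have "continuous_on T (\<lambda>u. \<sigma> u y)" by simp
  then have op: "open ((\<lambda>u. \<sigma> u y) -` V \<inter> T)"
    using T V by (simp add: continuous_on_open_vimage)
  let ?S = "V \<inter> (\<lambda>z. p z - p y) -` ((\<lambda>u. \<sigma> u y) -` V \<inter> T)"
  have "continuous_on UNIV (\<lambda>z. p z - p y)"
    by (intro continuous_intros continuous_p)
  then have "open ((\<lambda>z. p z - p y) -` ((\<lambda>u. \<sigma> u y) -` V \<inter> T))"
    by (rule open_vimage[OF op])
  show thesis
  proof (rule that[of ?S])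
    show "open ?S" using \<open>open (_ -` _)\<close> V(1) by blast
    show "y \<in> ?S" using V(2) T(2) by (simp add: shift_0)
    show "\<forall>z\<in>?S. \<exists>u\<in>T. z = \<sigma> u y"
    proof (intro ballI bexI)
      fix z assume z: "z \<in> ?S"
      show "p z - p y \<in> T" using z by simp
      then have "p (\<sigma> (p z - p y) y) = p z"
        using p_shift T(3) by (simp add: subset_iff)
      then show "z = \<sigma> (p z - p y) y"
        by (intro inj_onD[OF V(3)]) (use z in auto)
    qed
  qed
qed

definition words :: "('x \<Rightarrow> 'x) set"
  where "words = foldr \<sigma> ` lists U"

lemma shift_foldr_commute:
  "u \<in> U \<Longrightarrow> us \<in> lists U \<Longrightarrow> \<sigma> u (foldr \<sigma> us x) = foldr \<sigma> us (\<sigma> u x)"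
proof (induction us)
  case (Cons v us)
  then have "\<sigma> u (foldr \<sigma> (v # us) x) = \<sigma> v (\<sigma> u (foldr \<sigma> us x))"
    using shift_commute[of u v] by simp
  then show ?case using Cons by simp
qed simp

lemma foldr_commute:
  "us \<in> lists U \<Longrightarrow> vs \<in> lists U \<Longrightarrow> foldr \<sigma> us (foldr \<sigma> vs x) = foldr \<sigma> vs (foldr \<sigma> us x)"
proof (induction us)
  case (Cons u us)
  then show ?case using shift_foldr_commute[of u vs] by simp
qed simp

lemma words_comp: "\<theta> \<in> words \<Longrightarrow> \<theta>' \<in> words \<Longrightarrow> \<theta> \<circ> \<theta>' \<in> words"
proof -
  assume "\<theta> \<in> words" "\<theta>' \<in> words"
  then obtain us vs where "us \<in> lists U" "vs \<in> lists U" "\<theta> = foldr \<sigma> us" "\<theta>' = foldr \<sigma> vs"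
    by (auto simp: words_def)
  then have "us @ vs \<in> lists U" "\<theta> \<circ> \<theta>' = foldr \<sigma> (us @ vs)"
    by (simp_all add: fun_eq_iff)
  then show ?thesis unfolding words_def by (metis image_eqI)
qed

lemma words_commute: "\<theta> \<in> words \<Longrightarrow> \<theta>' \<in> words \<Longrightarrow> \<theta> (\<theta>' x) = \<theta>' (\<theta> x)"
  using foldr_commute by (auto simp: words_def)

lemma id_words: "id \<in> words"
  unfolding words_def by (rule image_eqI[of _ _ "[]"]) (simp_all add: fun_eq_iff)

lemma shift_words: "u \<in> U \<Longrightarrow> \<sigma> u \<in> words"
  unfolding words_def by (rule image_eqI[of _ _ "[u]"]) (simp_all add: fun_eq_iff)

lemma continuous_words: "\<theta> \<in> words \<Longrightarrow> continuous_on UNIV \<theta>"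
proof -
  have "continuous_on UNIV (foldr \<sigma> us)" if "us \<in> lists U" for us
    using that
  proof (induction us)
    case (Cons u us)
    then have "continuous_on UNIV (\<lambda>x. \<sigma> u (foldr \<sigma> us x))"
      by (intro continuous_on_compose2[OF continuous_shift]) auto
    then show ?case by (simp add: comp_def)
  qed (simp add: id_def)
  then show "\<theta> \<in> words \<Longrightarrow> continuous_on UNIV \<theta>" by (auto simp: words_def)
qed

lemma p_words: "\<theta> \<in> words \<Longrightarrow> p (\<theta> x) - p x = p (\<theta> y) - p y"
proof -
  have "p (foldr \<sigma> us x) = p x + sum_list us" if "us \<in> lists U" for us x
    using that by (induction us) (simp_all add: p_shift ac_simps)
  moreover assume "\<theta> \<in> words"
  then obtain us where "us \<in> lists U" "\<theta> = foldr \<sigma> us" by (auto simp: words_def)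
  ultimately show "p (\<theta> x) - p x = p (\<theta> y) - p y" by simp
qed

text \<open>Orbits are open by \<open>shift_nbhd\<close> and the shifts are invertible, so orbits are also closed.\<close>

lemma words_transitive: "\<exists>\<theta>\<in>words. \<theta> x = y"
proof -
  define R where "R y \<longleftrightarrow> (\<exists>\<theta>\<in>words. \<theta> x = y)" for y
  have step: "R (\<sigma> u w)" if u: "u \<in> U" and "R w" for u w
  proof -
    obtain \<theta> where "\<theta> \<in> words" "\<theta> x = w" using \<open>R w\<close> by (auto simp: R_def)
    then have "\<sigma> u \<circ> \<theta> \<in> words" "(\<sigma> u \<circ> \<theta>) x = \<sigma> u w"
      using words_comp[OF shift_words[OF u]] by simp_all
    then show ?thesis unfolding R_def by blast
  qed
  have R_shift: "R (\<sigma> u w) = R w" if u: "u \<in> U" for u w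
    using step[OF u, of w] step[OF uminus_U[OF u], of "\<sigma> u w"] shift_uminus[OF u, of w] by auto
  have "\<exists>S. open S \<and> y \<in> S \<and> (\<forall>z\<in>S. R z = R y)" for y
  proof -
    obtain S where S: "open S" "y \<in> S" and Su: "\<forall>z\<in>S. \<exists>u\<in>U. z = \<sigma> u y"
      by (rule shift_nbhd[OF open_U zero_U order_refl])
    have "R z = R y" if z: "z \<in> S" for z
    proof -
      obtain u where "u \<in> U" "z = \<sigma> u y" using Su[rule_format, OF z] by (elim bexE)
      then show ?thesis using R_shift by simp
    qed
    with S show ?thesis by (intro exI[of _ S] conjI ballI)
  qed
  from constant_if_locally[OF connected_total, of R, OF this, of x y]
  have "R x = R y" .
  moreover have "R x" unfolding R_def using id_words by (intro bexI[of _ id]) simp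
  ultimately have "R y" by simp
  then show ?thesis by (simp add: R_def)
qed

text \<open>A transitive abelian group of permutations acts freely. The total space thus becomes an abelian group, a
torsor of \<open>words\<close>, mapped to the base group with kernel of order \<open>k\<close>.\<close>

lemma words_free:
  assumes "\<theta> \<in> words" "\<theta>' \<in> words" "\<theta> x = \<theta>' x"
  shows "\<theta> = \<theta>'"
proof
  fix y
  obtain \<phi> where \<phi>: "\<phi> \<in> words" "\<phi> x = y"
    using words_transitive by blast
  have "\<theta> (\<phi> x) = \<theta>' (\<phi> x)"
    using words_commute[OF assms(1) \<phi>(1), of x] words_commute[OF assms(2) \<phi>(1), of x] assms(3) by simp
  then show "\<theta> y = \<theta>' y" by (simp add: \<phi>(2))
qed

definition word_group :: "('x \<Rightarrow> 'x) monoid"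
  where "word_group = \<lparr>carrier = words, mult = (\<circ>), one = id\<rparr>"

lemma comm_group_words: "comm_group word_group"
proof (rule comm_groupI)
  fix \<theta> assume "\<theta> \<in> carrier word_group"
  then have \<theta>: "\<theta> \<in> words" by (simp add: word_group_def)
  obtain \<phi> where \<phi>: "\<phi> \<in> words" "\<phi> (\<theta> undefined) = undefined"
    using words_transitive by blast
  have "\<phi> \<circ> \<theta> = id"
    by (rule words_free[OF words_comp[OF \<phi>(1) \<theta>] id_words, of undefined]) (simp add: \<phi>(2))
  then show "\<exists>\<phi>\<in>carrier word_group. \<phi> \<otimes>\<^bsub>word_group\<^esub> \<theta> = \<one>\<^bsub>word_group\<^esub>"
    using \<phi>(1) by (auto simp: word_group_def)
next
  show "\<theta> \<otimes>\<^bsub>word_group\<^esub> \<theta>' = \<theta>' \<otimes>\<^bsub>word_group\<^esub> \<theta>"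
    if "\<theta> \<in> carrier word_group" "\<theta>' \<in> carrier word_group" for \<theta> \<theta>'
  proof
    show "(\<theta> \<otimes>\<^bsub>word_group\<^esub> \<theta>') x = (\<theta>' \<otimes>\<^bsub>word_group\<^esub> \<theta>) x" for x
      using that words_commute[of \<theta> \<theta>' x] by (simp add: word_group_def)
  qed
qed (simp_all add: word_group_def words_comp id_words comp_assoc)

text \<open>The group of words is presented as a quotient of the free abelian group on the points of the total space,
where each generator carries the base point to the point it stands for. Characters can then be sought
on a group that is a type.\<close>

lemma free_action:
  obtains act :: "('x \<Rightarrow>\<^sub>0 int) \<Rightarrow> 'x \<Rightarrow> 'x"
  where "\<And>c. act c \<in> words" "\<And>c c' x. act (c + c') x = act c (act c' x)"
    "\<And>y. act (frag_of y) x0 = y"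
proof -
  interpret comm_group word_group by (rule comm_group_words)
  have "\<exists>\<theta>. \<theta> \<in> words \<and> \<theta> x0 = y" for y
    using words_transitive[of x0 y] by blast
  then obtain \<theta> where \<theta>: "\<And>y. \<theta> y \<in> words" "\<And>y. \<theta> y x0 = y"
    by metis
  have "\<theta> ` UNIV \<subseteq> carrier word_group"
    using \<theta>(1) by (auto simp: word_group_def)
  then obtain h where h: "h \<in> hom (free_Abelian_group UNIV) word_group"
    and h1: "\<And>y. y \<in> UNIV \<Longrightarrow> h (frag_of y) = \<theta> y"
    using free_Abelian_group_universal by blast
  show thesis
  proof (rule that[of h])
    show "h c \<in> words" for c
      using hom_in_carrier[OF h, of c] by (simp add: word_group_def)
    show "h (c + c') x = h c (h c' x)" for c c' x
      using hom_mult[OF h, of c c'] by (simp add: word_group_def free_Abelian_group_def)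
    show "h (frag_of y) x0 = y" for y
      using h1[of y] \<theta>(2) by simp
  qed
qed

text \<open>Joint continuity of \<open>\<sigma> u x\<close> at \<open>u = 0\<close> becomes uniform in \<open>x\<close> by compactness.\<close>

lemma uniformly_small_shifts:
  fixes f :: "'x \<Rightarrow> real"
  assumes f: "continuous_on UNIV f" and \<epsilon>: "0 < \<epsilon>"
  obtains T where "open T" "0 \<in> T" "T \<subseteq> U" "\<And>u x. u \<in> T \<Longrightarrow> \<bar>f (\<sigma> u x) - f x\<bar> < \<epsilon>"
proof -
  let ?g = "\<lambda>z. f ((\<lambda>(x, u). \<sigma> u x) z) - f (fst z)"
  have "continuous_on (UNIV \<times> U) ?g"
    by (intro continuous_intros continuous_on_compose2[OF f] continuous_shift2) auto
  then have op: "open (?g -` ball 0 \<epsilon> \<inter> UNIV \<times> U)"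
    using open_U by (simp add: continuous_on_open_vimage open_Times)
  have "\<exists>A B. open A \<and> open B \<and> x \<in> A \<and> 0 \<in> B \<and> A \<times> B \<subseteq> ?g -` ball 0 \<epsilon> \<inter> UNIV \<times> U" for x
  proof -
    have "(x, 0) \<in> ?g -` ball 0 \<epsilon> \<inter> UNIV \<times> U"
      using \<epsilon> zero_U by (simp add: shift_0)
    then obtain A B where "open A" "open B" "(x, 0) \<in> A \<times> B"
      "A \<times> B \<subseteq> ?g -` ball 0 \<epsilon> \<inter> UNIV \<times> U"
      by (rule open_prod_elim[OF op])
    then show ?thesis by (intro exI[of _ A] exI[of _ B] conjI) simp_all
  qed
  then have "\<forall>x. \<exists>A B. open A \<and> open B \<and> x \<in> A \<and> 0 \<in> B \<and>
      A \<times> B \<subseteq> ?g -` ball 0 \<epsilon> \<inter> UNIV \<times> U" by (rule allI)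
  then obtain A B where "\<forall>x. open (A x) \<and> open (B x) \<and> x \<in> A x \<and> 0 \<in> B x \<and>
      A x \<times> B x \<subseteq> ?g -` ball 0 \<epsilon> \<inter> UNIV \<times> U"
    by (simp only: choice_iff) (elim exE)
  then have AB: "\<And>x. open (A x)" "\<And>x. open (B x)" "\<And>x. x \<in> A x" "\<And>x. 0 \<in> B x"
    "\<And>x. A x \<times> B x \<subseteq> ?g -` ball 0 \<epsilon> \<inter> UNIV \<times> U"
    by (simp_all only: simp_thms)
  have "(UNIV :: 'x set) \<subseteq> (\<Union>x\<in>UNIV. A x)" using AB(3) by blast
  then obtain I where I: "finite I" "UNIV \<subseteq> (\<Union>x\<in>I. A x)"
    by (rule compactE_image[OF compact_total AB(1)])
  show thesis
  proof (rule that[of "U \<inter> (\<Inter>x\<in>I. B x)"])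
    show "open (U \<inter> (\<Inter>x\<in>I. B x))"
      using open_U AB(2) I(1) by (intro open_Int open_INT) auto
    show "0 \<in> U \<inter> (\<Inter>x\<in>I. B x)" using zero_U AB(4) by blast
    show "\<bar>f (\<sigma> u x) - f x\<bar> < \<epsilon>" if "u \<in> U \<inter> (\<Inter>x\<in>I. B x)" for u x
    proof -
      obtain i where "i \<in> I" "x \<in> A i" using I(2) by blast
      then have "(x, u) \<in> A i \<times> B i" using that by blast
      then have "(x, u) \<in> ?g -` ball 0 \<epsilon>" using AB(5) by blast
      then show ?thesis by simp
    qed
  qed blast
qed

end

section \<open>Characters of the covering space\<close>

locale shift_action = shift_family p k U \<sigma>
  for p :: "'x::t2_space \<Rightarrow> 'g::{topological_ab_group_add, t2_space}" and k U \<sigma> +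
  fixes x0 :: 'x and act :: "('x \<Rightarrow>\<^sub>0 int) \<Rightarrow> 'x \<Rightarrow> 'x"
  assumes act_words: "\<And>c. act c \<in> words"
    and act_add: "\<And>c c' x. act (c + c') x = act c (act c' x)"
    and act_base: "\<And>y. act (frag_of y) x0 = y"
begin

lemma act_eqI: "act c x = act c' x \<Longrightarrow> act c = act c'"
  by (rule words_free[OF act_words act_words])

lemma act_0: "act 0 = id"
  by (rule words_free[OF act_words id_words, of _ "act 0 undefined"]) (simp flip: act_add)

lemma act_uminus: "act (- c) (act c x) = x"
  using act_add[of "- c" c x] by (simp add: act_0)

lemma act_diff_id:
  assumes "act c = act c'"
  shows "act (c - c') = id"
proof
  fix x
  have "act (- c' + c) x = x"
    by (simp only: act_add assms act_uminus)
  then show "act (c - c') x = id x" by simp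
qed

lemma act_base_id: "act (frag_of x0) = id"
  by (rule words_free[OF act_words id_words, of _ x0]) (simp add: act_base)

text \<open>The translation of the base that lies below the permutation \<open>act c\<close>.\<close>

definition disp :: "('x \<Rightarrow>\<^sub>0 int) \<Rightarrow> 'g"
  where "disp c = p (act c x0) - p x0"

lemma p_act: "p (act c x) = p x + disp c"
  unfolding disp_def p_words[OF act_words, of c x0 x] by (simp add: algebra_simps)

lemma disp_add: "disp (c + c') = disp c + disp c'"
proof -
  have "p (act (c + c') x0) = p x0 + (disp c + disp c')"
    by (simp only: act_add p_act add.assoc add.commute[of "disp c'"])
  then show ?thesis
    unfolding disp_def[of "c + c'"] by simp
qed

lemma disp_frag_of: "disp (frag_of x) = p x - p x0"
  by (simp add: disp_def act_base)

text \<open>How far \<open>act c\<close> moves \<open>f\<close> in the uniform norm: a seminorm on the free group that is continuous along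
the total space and detects the points where \<open>f\<close> differs from its value at the base point.\<close>

definition osc :: "('x \<Rightarrow> real) \<Rightarrow> ('x \<Rightarrow>\<^sub>0 int) \<Rightarrow> real"
  where "osc f c = (SUP x. \<bar>f (act c x) - f x\<bar>)"

context
  fixes f :: "'x \<Rightarrow> real"
  assumes f: "continuous_on UNIV f"
begin

lemma osc_upper: "\<bar>f (act c x) - f x\<bar> \<le> osc f c"
proof -
  have "bounded (range f)"
    using compact_continuous_image[OF f compact_total] by (rule compact_imp_bounded)
  then obtain b where b: "\<And>x. \<bar>f x\<bar> \<le> b"
    by (auto simp: bounded_iff)
  have "\<bar>f (act c x) - f x\<bar> \<le> 2 * b" for x
    using b[of x] b[of "act c x"] by linarith
  then have "bdd_above (range (\<lambda>x. \<bar>f (act c x) - f x\<bar>))"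
    by (intro bdd_aboveI[of _ "2 * b"]) auto
  then show ?thesis
    unfolding osc_def by (rule cSUP_upper2[where x = x]) auto
qed

lemma osc_least: "(\<And>x. \<bar>f (act c x) - f x\<bar> \<le> b) \<Longrightarrow> osc f c \<le> b"
  unfolding osc_def by (rule cSUP_least) auto

lemma osc_id: "act c = id \<Longrightarrow> osc f c = 0"
  by (simp add: osc_def)

lemma group_seminorm_osc: "group_seminorm (osc f)"
proof
  show "osc f 0 = 0"
    by (rule osc_id[OF act_0])
  have le: "osc f (- c) \<le> osc f c" for c
  proof (rule osc_least)
    fix x
    show "\<bar>f (act (- c) x) - f x\<bar> \<le> osc f c"
      using osc_upper[of c "act (- c) x"] act_uminus[of "- c" x] by simp
  qed
  show "osc f (- c) = osc f c" for c
    using le[of c] le[of "- c"] by simp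
  show "osc f (c + c') \<le> osc f c + osc f c'" for c c'
  proof (rule osc_least)
    fix x
    show "\<bar>f (act (c + c') x) - f x\<bar> \<le> osc f c + osc f c'"
      using osc_upper[of c "act c' x"] osc_upper[of c' x] by (simp add: act_add)
  qed
qed

lemma osc_small_nbhd:
  assumes "0 < \<epsilon>"
  obtains S where "open S" "x \<in> S" "\<And>c. act c x \<in> S \<Longrightarrow> osc f c \<le> \<epsilon>"
proof -
  obtain T where T: "open T" "0 \<in> T" "T \<subseteq> U" and small: "\<And>u x. u \<in> T \<Longrightarrow> \<bar>f (\<sigma> u x) - f x\<bar> < \<epsilon>"
    using uniformly_small_shifts[OF f assms] by blast
  obtain S where S: "open S" "x \<in> S" "\<forall>z\<in>S. \<exists>u\<in>T. z = \<sigma> u x"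
    by (rule shift_nbhd[OF T])
  show thesis
  proof (rule that[OF S(1,2)])
    fix c assume "act c x \<in> S"
    with S(3) obtain u where u: "u \<in> T" "act c x = \<sigma> u x" by blast
    then have "act c = \<sigma> u"
      using T(3) by (intro words_free[OF act_words shift_words]) auto
    then show "osc f c \<le> \<epsilon>"
      using small[OF u(1)] by (intro osc_least) (simp add: less_imp_le)
  qed
qed

text \<open>The translates of a neighbourhood of \<open>x0\<close> on which \<open>osc\<close> is small cover the compact total space; finitely many suffice.\<close>

lemma tot_bounded_osc: "group_seminorm.tot_bounded (osc f)"
  unfolding group_seminorm.tot_bounded_def[OF group_seminorm_osc]
proof (intro allI impI)
  fix \<epsilon> :: real assume "0 < \<epsilon>"
  then have "0 < \<epsilon> / 2" by simp
  then obtain S where S: "open S" "x0 \<in> S" and small: "\<And>c. act c x0 \<in> S \<Longrightarrow> osc f c \<le> \<epsilon> / 2"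
    using osc_small_nbhd by blast
  define V where "V c = act (- c) -` S" for c
  have "open (V c)" for c
    unfolding V_def using continuous_words[OF act_words] S(1) by (simp add: continuous_on_open_vimage)
  moreover have "UNIV \<subseteq> (\<Union>c\<in>UNIV. V c)"
  proof
    fix y
    have "act (- frag_of y) y = x0"
      using act_uminus[of "frag_of y" x0] by (simp add: act_base)
    then have "y \<in> V (frag_of y)" using S(2) by (simp add: V_def)
    then show "y \<in> (\<Union>c\<in>UNIV. V c)" by blast
  qed
  ultimately obtain C where C: "finite C" "UNIV \<subseteq> (\<Union>c\<in>C. V c)"
    by (rule compactE_image[OF compact_total])
  have "\<exists>c\<in>C. osc f (x - c) < \<epsilon>" for x
  proof -
    obtain c where c: "c \<in> C" "act x x0 \<in> V c" using C(2) by blast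
    then have "act (- c + x) x0 \<in> S" by (simp only: V_def act_add vimage_eq)
    then have "osc f (x - c) \<le> \<epsilon> / 2" using small[of "- c + x"] by simp
    then show ?thesis using c(1) \<open>0 < \<epsilon>\<close> by (intro bexI[of _ c]) auto
  qed
  with C(1) show "\<exists>C. finite C \<and> (\<forall>x. \<exists>c\<in>C. osc f (x - c) < \<epsilon>)" by blast
qed

context
  fixes \<psi> :: "('x \<Rightarrow>\<^sub>0 int) \<Rightarrow> complex" and K :: real
  assumes norm_\<psi>: "\<And>c. norm (\<psi> c) = 1" and \<psi>_add: "\<And>c c'. \<psi> (c + c') = \<psi> c * \<psi> c'"
    and lipschitz: "\<And>c. norm (\<psi> c - 1) \<le> K * osc f c"
begin

lemma \<psi>_id: "act c = id \<Longrightarrow> \<psi> c = 1"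
proof -
  assume "act c = id"
  then have "osc f c = 0" by (rule osc_id)
  then show ?thesis using lipschitz[of c] by simp
qed

text \<open>A Lipschitz character is 1 on elements that act trivially, so it descends to the function
\<open>x \<mapsto> \<psi> (frag_of x)\<close> on the total space, which \<open>act c\<close> multiplies by \<open>\<psi> c\<close>.\<close>

lemma \<psi>_act: "\<psi> (frag_of (act c x)) = \<psi> c * \<psi> (frag_of x)"
proof -
  have "act (frag_of (act c x)) x0 = act (c + frag_of x) x0"
    by (simp add: act_base act_add)
  then have "act (frag_of (act c x)) = act (c + frag_of x)"
    by (rule act_eqI)
  then have "\<psi> (frag_of (act c x) - (c + frag_of x)) = 1"
    by (intro \<psi>_id act_diff_id)
  then show ?thesis
    using \<psi>_add[of "frag_of (act c x) - (c + frag_of x)" "c + frag_of x"] \<psi>_add[of c "frag_of x"]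
    by simp
qed

lemma continuous_\<psi>: "continuous_on UNIV (\<lambda>x. \<psi> (frag_of x))"
  unfolding continuous_on_def
proof
  fix x
  show "((\<lambda>x. \<psi> (frag_of x)) \<longlongrightarrow> \<psi> (frag_of x)) (at x within UNIV)"
  proof (rule tendstoI)
    fix \<epsilon> :: real assume "0 < \<epsilon>"
    define \<delta> where "\<delta> = \<epsilon> / (\<bar>K\<bar> + 1)"
    have "0 < \<delta>" using \<open>0 < \<epsilon>\<close> by (simp add: \<delta>_def)
    then obtain S where S: "open S" "x \<in> S" and small: "\<And>c. act c x \<in> S \<Longrightarrow> osc f c \<le> \<delta>"
      using osc_small_nbhd by blast
    have "dist (\<psi> (frag_of y)) (\<psi> (frag_of x)) < \<epsilon>" if "y \<in> S" for y
    proof -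
      define c where "c = frag_of y + - frag_of x"
      have "act (- frag_of x) x = x0"
        using act_uminus[of "frag_of x" x0] by (simp add: act_base)
      then have c: "act c x = y"
        by (simp only: c_def act_add act_base)
      have "norm (\<psi> c - 1) \<le> K * osc f c"
        by (rule lipschitz)
      also have "\<dots> \<le> \<bar>K\<bar> * \<delta>"
        using small[of c] c that group_seminorm.nonneg[OF group_seminorm_osc, of c]
        by (intro mult_mono) auto
      also have "\<dots> < \<epsilon>"
        using \<open>0 < \<epsilon>\<close> by (simp add: \<delta>_def field_simps)
      finally have "norm (\<psi> c - 1) < \<epsilon>" .
      moreover have "\<psi> (frag_of y) - \<psi> (frag_of x) = (\<psi> c - 1) * \<psi> (frag_of x)"
        using \<psi>_act[of c x] c by (simp add: algebra_simps)
      ultimately show ?thesis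
        by (simp add: dist_norm norm_mult norm_\<psi>)
    qed
    then show "\<forall>\<^sub>F y in at x within UNIV. dist (\<psi> (frag_of y)) (\<psi> (frag_of x)) < \<epsilon>"
      using S unfolding eventually_at_topological by blast
  qed
qed

text \<open>If \<open>c\<close> moves the base by 0, then \<open>act c\<close> permutes the \<open>k\<close> points of a fibre. The product of the descended
character over the fibre is therefore unchanged, while each factor is multiplied by \<open>\<psi> c\<close>.\<close>

lemma power_\<psi>_fibre:
  assumes "disp c = 0"
  shows "\<psi> c ^ k = 1"
proof -
  let ?F = "p -` {p x0}"
  let ?P = "\<Prod>y\<in>?F. \<psi> (frag_of y)"
  have "?P = (\<Prod>y\<in>?F. \<psi> (frag_of (act c y)))"
  proof (rule prod.reindex_bij_witness[where i = "act c" and j = "act (- c)"])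
    have "disp (- c) = 0"
      using disp_add[of c "- c"] assms by (simp add: disp_def act_0)
    then show "act (- c) y \<in> ?F" if "y \<in> ?F" for y
      using that by (simp add: p_act)
    show "act c y \<in> ?F" if "y \<in> ?F" for y
      using that assms by (simp add: p_act)
    show "act c (act (- c) y) = y" "act (- c) (act c y) = y" for y
      using act_uminus[of "- c" y] act_uminus[of c y] by simp_all
    show "\<psi> (frag_of (act c (act (- c) y))) = \<psi> (frag_of y)" for y
      using act_uminus[of "- c" y] by simp
  qed
  also have "\<dots> = (\<Prod>y\<in>?F. \<psi> c) * ?P"
    by (simp only: \<psi>_act prod.distrib)
  also have "(\<Prod>y\<in>?F. \<psi> c) = \<psi> c ^ k"
    by (simp only: prod_constant card_fibre)
  finally have "?P * \<psi> c ^ k = ?P * 1" by simp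
  moreover have "?P \<noteq> 0"
  proof -
    have "\<psi> (frag_of y) \<noteq> 0" for y using norm_\<psi>[of "frag_of y"] by auto
    then show ?thesis using finite_fibre by simp
  qed
  ultimately show ?thesis by (metis mult_left_cancel)
qed

lemma power_\<psi>_eq:
  assumes "disp c = disp c'"
  shows "\<psi> c ^ k = \<psi> c' ^ k"
proof -
  have "disp c = disp (c - c') + disp c'"
    using disp_add[of "c - c'" c'] unfolding diff_add_cancel .
  then have "disp (c - c') = 0"
    unfolding assms by (metis add_0 add_right_imp_eq)
  then have "\<psi> (c - c') ^ k = 1" by (rule power_\<psi>_fibre)
  then show ?thesis
    using \<psi>_add[of "c - c'" c'] by (simp add: power_mult_distrib)
qed

text \<open>The \<open>k\<close>-th power of \<open>\<psi>\<close> depends only on the translation of the base, and it is continuous there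
because \<open>p\<close> is an open surjection.\<close>

lemma power_descends:
  obtains \<eta> where "\<eta> \<in> characters" "\<And>c. \<eta> (disp c) = \<psi> c ^ k"
proof -
  have ex: "\<exists>c. disp c = g" for g
  proof -
    obtain x where "p x = g + p x0" using surj_p by (metis surjD)
    then have "disp (frag_of x) = g" by (simp add: disp_frag_of)
    then show ?thesis by blast
  qed
  define \<eta> where "\<eta> g = \<psi> (SOME c. disp c = g) ^ k" for g
  have \<eta>: "\<eta> (disp c) = \<psi> c ^ k" for c
    unfolding \<eta>_def by (rule power_\<psi>_eq) (rule someI_ex[OF ex])
  have "\<eta> \<in> characters"
    unfolding characters_def
  proof (intro CollectI conjI allI)
    have "open ((\<lambda>y. \<eta> (y - p x0)) -` B)" if B: "open B" for B
    proof -
      have "continuous_on UNIV (\<lambda>x. \<psi> (frag_of x) ^ k)"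
        by (intro continuous_intros continuous_\<psi>)
      then have "open ((\<lambda>x. \<psi> (frag_of x) ^ k) -` B)"
        using B by (simp add: continuous_on_open_vimage)
      moreover have "(\<lambda>y. \<eta> (y - p x0)) -` B = p ` ((\<lambda>x. \<psi> (frag_of x) ^ k) -` B)"
      proof -
        have eq: "\<eta> (p x - p x0) = \<psi> (frag_of x) ^ k" for x
          using \<eta>[of "frag_of x"] by (simp add: disp_frag_of)
        show ?thesis
        proof
          show "(\<lambda>y. \<eta> (y - p x0)) -` B \<subseteq> p ` ((\<lambda>x. \<psi> (frag_of x) ^ k) -` B)"
          proof
            fix y assume y: "y \<in> (\<lambda>y. \<eta> (y - p x0)) -` B"
            obtain x where x: "y = p x" using surj_p by (metis surjD)
            with y eq[of x] show "y \<in> p ` ((\<lambda>x. \<psi> (frag_of x) ^ k) -` B)" by simp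
          qed
          show "p ` ((\<lambda>x. \<psi> (frag_of x) ^ k) -` B) \<subseteq> (\<lambda>y. \<eta> (y - p x0)) -` B"
            by (auto simp: eq)
        qed
      qed
      ultimately show ?thesis using open_map_p by simp
    qed
    then have "continuous_on UNIV (\<lambda>y. \<eta> (y - p x0))"
      by (simp add: continuous_on_open_vimage)
    then have "continuous_on UNIV (\<lambda>g. (\<lambda>y. \<eta> (y - p x0)) (g + p x0))"
      by (rule continuous_on_compose2) (auto intro!: continuous_intros)
    then show "continuous_on UNIV \<eta>" by simp
  next
    fix g h
    obtain c where c: "disp c = g" using ex by blast
    show "\<eta> g \<in> sphere 0 1"
      using \<eta>[of c] c norm_\<psi>[of c] by (simp add: norm_power)
    obtain c' where c': "disp c' = h" using ex by blast
    show "\<eta> (g + h) = \<eta> g * \<eta> h"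
      using \<eta>[of "c + c'"] \<eta>[of c] \<eta>[of c'] c c' by (simp add: disp_add \<psi>_add power_mult_distrib)
  qed
  then show thesis using that \<eta> by blast
qed

text \<open>Divisibility provides a character \<open>\<phi>\<close> of the base whose \<open>k\<close>-th power is the descended one. The
quotient of \<open>\<psi>\<close> by the pullback of \<open>\<phi>\<close> takes values in the \<open>k\<close>-th roots of unity, so it is constant
on the connected total space, and \<open>\<psi>\<close> itself comes from the base.\<close>

lemma fibre_in_kernel:
  assumes div: "divisible_by k (character_group :: ('g \<Rightarrow> complex) monoid)" and x: "p x = p x0"
  shows "\<psi> (frag_of x) = 1"
proof -
  obtain \<eta> where \<eta>: "\<eta> \<in> characters" "\<And>c. \<eta> (disp c) = \<psi> c ^ k"
    by (rule power_descends) blast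
  have "\<eta> \<in> (\<lambda>f. f [^]\<^bsub>character_group\<^esub> k) ` carrier character_group"
    using div \<eta>(1) unfolding divisible_by_def by (simp add: character_group_def)
  then obtain \<phi> where \<phi>: "\<phi> \<in> characters" "\<eta> = (\<lambda>x. \<phi> x ^ k)"
    by (auto simp: character_group_pow) (simp add: character_group_def)
  have cont: "continuous_on UNIV \<phi>" and n: "\<And>g. norm (\<phi> g) = 1" and add: "\<And>g h. \<phi> (g + h) = \<phi> g * \<phi> h"
    using \<phi>(1) by (auto simp: characters_def)
  have nz: "\<phi> g \<noteq> 0" for g using n[of g] by auto
  have "\<phi> 0 = 1"
    using add[of 0 0] nz[of 0] by simp
  define r where "r x = \<psi> (frag_of x) / \<phi> (p x - p x0)" for x
  have "continuous_on UNIV (\<lambda>x. \<phi> (p x - p x0))"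
    by (rule continuous_on_compose2[OF cont]) (auto intro!: continuous_intros continuous_p)
  then have cont_r: "continuous_on UNIV r"
    unfolding r_def using nz by (intro continuous_intros continuous_\<psi>) auto
  have "r x ^ k = 1" for x
  proof -
    have "\<psi> (frag_of x) ^ k = \<phi> (p x - p x0) ^ k"
      using \<eta>(2)[of "frag_of x"] by (simp add: \<phi>(2) disp_frag_of)
    then show ?thesis
      using nz by (simp add: r_def power_divide)
  qed
  then have "range r \<subseteq> {z. z ^ k = 1}" by auto
  moreover have "1 \<le> k" using covering by (simp add: fold_covering_def)
  ultimately have "finite (range r)"
    by (intro finite_subset[OF _ finite_roots_unity])
  then have "r constant_on UNIV"
    by (rule continuous_finite_range_constant[OF connected_total cont_r])
  then have "r x = r x0" unfolding constant_on_def by (metis UNIV_I)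
  moreover have "r x0 = 1"
    using \<psi>_id[OF act_base_id] \<open>\<phi> 0 = 1\<close> by (simp add: r_def)
  ultimately show ?thesis
    using x \<open>\<phi> 0 = 1\<close> by (simp add: r_def)
qed

end

end

text \<open>A continuous function that separates \<open>x\<close> from the base point makes \<open>osc\<close> positive at \<open>x\<close>, and then
some Lipschitz character is not 1 there.\<close>

lemma fibre_trivial:
  assumes div: "divisible_by k (character_group :: ('g \<Rightarrow> complex) monoid)" and x: "p x = p x0"
  shows "x = x0"
proof (rule ccontr)
  assume "x \<noteq> x0"
  have "closedin euclidean {x0}" "closedin euclidean {x}" "disjnt {x0} {x}"
    using \<open>x \<noteq> x0\<close> by auto
  then obtain f :: "'x \<Rightarrow> real" where "continuous_map euclidean euclideanreal f" "f ` {x0} \<subseteq> {0}" "f ` {x} \<subseteq> {1}"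
    by (rule Urysohn_lemma_alt[OF normal_space_compact_t2[OF compact_total]])
  then have f: "continuous_on UNIV f" "f x0 = 0" "f x = 1"
    by auto
  interpret group_seminorm "osc f"
    by (rule group_seminorm_osc[OF f(1)])
  have pos: "0 < osc f (frag_of x)"
    using osc_upper[OF f(1), of "frag_of x" x0] f(2,3) by (simp add: act_base)
  show False
  proof (rule lipschitz_character[OF tot_bounded_osc[OF f(1)] pos])
    fix \<psi> :: "('x \<Rightarrow>\<^sub>0 int) \<Rightarrow> complex" and K
    assume "\<And>c. cmod (\<psi> c) = 1" "\<And>c c'. \<psi> (c + c') = \<psi> c * \<psi> c'"
      "\<And>c. cmod (\<psi> c - 1) \<le> K * osc f c"
    from fibre_in_kernel[OF f(1) this div x] have "\<psi> (frag_of x) = 1" .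
    moreover assume "\<psi> (frag_of x) \<noteq> 1"
    ultimately show False by contradiction
  qed
qed

end

section \<open>Injectivity of the covering map\<close>

theorem theorem2:
  fixes p :: "'x::t2_space \<Rightarrow> 'g::{topological_ab_group_add, t2_space}"
    and k :: nat
  assumes "compact (UNIV :: 'g set)"
    and "connected (UNIV :: 'g set)"
    and "connected (UNIV :: 'x set)"
    and "fold_covering k p"
    and "divisible_by k (character_group :: ('g \<Rightarrow> complex) monoid)"
  shows "\<exists>q. homeomorphism (UNIV :: 'x set) (UNIV :: 'g set) p q"
proof -
  interpret compact_group_covering p k
    using assms by unfold_locales
  obtain U \<sigma> where "shift_family p k U \<sigma>"
  proof (rule commuting_shifts)
    fix U \<sigma>
    assume "open U" "0 \<in> U" "\<And>u x. u \<in> U \<Longrightarrow> p (\<sigma> u x) = p x + u"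
      "continuous_on (UNIV \<times> U) (\<lambda>(x, u). \<sigma> u x)" "\<And>x. \<sigma> 0 x = x"
      "\<And>u v x. u \<in> U \<Longrightarrow> v \<in> U \<Longrightarrow> \<sigma> u (\<sigma> v x) = \<sigma> v (\<sigma> u x)"
      "\<And>u. u \<in> U \<Longrightarrow> - u \<in> U" "\<And>u x. u \<in> U \<Longrightarrow> \<sigma> (- u) (\<sigma> u x) = x"
    then have "shift_family p k U \<sigma>"
      by unfold_locales
    then show thesis by (rule that)
  qed
  then interpret shift_family p k U \<sigma> .
  have "inj p"
  proof (rule injI)
    fix x x0 assume px: "p x = p x0"
    obtain act where act: "shift_action p k U \<sigma> x0 act"
    proof (rule free_action[of x0])
      fix act :: "('x \<Rightarrow>\<^sub>0 int) \<Rightarrow> 'x \<Rightarrow> 'x"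
      assume "\<And>c. act c \<in> words" "\<And>c c' x. act (c + c') x = act c (act c' x)"
        "\<And>y. act (frag_of y) x0 = y"
      then have "shift_action p k U \<sigma> x0 act"
        by unfold_locales
      then show thesis by (rule that)
    qed
    show "x = x0"
      by (rule shift_action.fibre_trivial[OF act assms(5) px])
  qed
  define q where "q = inv_into UNIV p"
  have qp: "q (p x) = x" and pq: "p (q y) = y" for x y
    using \<open>inj p\<close> surj_p by (simp_all add: q_def f_inv_into_f)
  have "open (q -` B)" if "open B" for B
  proof -
    have "q -` B = p ` B"
    proof
      show "q -` B \<subseteq> p ` B"
        using pq by (metis image_eqI subsetI vimageD)
      show "p ` B \<subseteq> q -` B"
        using qp by auto
    qed
    then show ?thesis using open_map_p[OF that] by simp
  qed
  then have "continuous_on UNIV q"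
    by (simp add: continuous_on_open_vimage)
  then have "homeomorphism UNIV UNIV p q"
    using continuous_p qp pq by (auto simp: homeomorphism_def surj_def) metis+
  then show ?thesis by blast
qed

end
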